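(* Let $\lambda,\kappa$ be infinite cardinals with $\lambda=\lambda^{<\lambda}>\kappa=\mathrm{cf}(\kappa)$. Then there is no $(\lambda,\kappa)$-superlimit model of $T_{\mathrm{ord}}$, the theory of dense linear orders with neither first nor last element.
   Context: For a complete first order theory $T$, $\mathrm{EC}_\lambda(T)$ is the class of models of $T$ of cardinality $\lambda$. A model $M$ of $T$ is $\lambda$-universal when every $N\in\mathrm{EC}_\lambda(T)$ can be elementarily embedded into $M$. $M\in\mathrm{EC}_\lambda(T)$ is a $(\lambda,\kappa)$-superlimit model when $M$ is $\lambda$-universal and: if $\delta<\lambda^+$ is a limit ordinal with $\mathrm{cf}(\delta)=\kappa$, $\langle M_\alpha:\alpha\le\delta\rangle$ is $\prec$-increasing continuous, and $M_{\alpha+1}$ is isomorphic to $M$ for every $\alpha<\delta$, then $M_\delta$ is isomorphic to $M$. For models of $T_{\mathrm{ord}}$, $\prec$ is the same as $\subseteq$. *)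

theory Defs
  imports Main
begin

unbundle cardinal_syntax

section \<open>First-order logic in the vocabulary \<open>{<}\<close>\<close>

record 'a ostruct =
  universe :: "'a set"
  lt :: "'a rel"

definition is_struct :: "'a ostruct \<Rightarrow> bool" where
  "is_struct M \<longleftrightarrow> universe M \<noteq> {} \<and> lt M \<subseteq> universe M \<times> universe M"

text \<open>Formulas have named variables \<open>0, 1, 2, \<dots>\<close>.\<close>

datatype fm =
    Eq nat nat
  | Less nat nat
  | Neg fm
  | Conj fm fm
  | Ex nat fm

abbreviation Disj :: "fm \<Rightarrow> fm \<Rightarrow> fm" where
  "Disj p q \<equiv> Neg (Conj (Neg p) (Neg q))"

abbreviation Imp :: "fm \<Rightarrow> fm \<Rightarrow> fm" where
  "Imp p q \<equiv> Neg (Conj p (Neg q))"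

abbreviation All :: "nat \<Rightarrow> fm \<Rightarrow> fm" where
  "All x p \<equiv> Neg (Ex x (Neg p))"

primrec sat :: "'a ostruct \<Rightarrow> (nat \<Rightarrow> 'a) \<Rightarrow> fm \<Rightarrow> bool" where
  "sat M s (Eq x y) \<longleftrightarrow> s x = s y"
| "sat M s (Less x y) \<longleftrightarrow> (s x, s y) \<in> lt M"
| "sat M s (Neg p) \<longleftrightarrow> \<not> sat M s p"
| "sat M s (Conj p q) \<longleftrightarrow> sat M s p \<and> sat M s q"
| "sat M s (Ex x p) \<longleftrightarrow> (\<exists>a\<in>universe M. sat M (s(x := a)) p)"

definition is_model :: "'a ostruct \<Rightarrow> fm set \<Rightarrow> bool" where
  "is_model M T \<longleftrightarrow>
     is_struct M \<and> (\<forall>p\<in>T. \<forall>s. range s \<subseteq> universe M \<longrightarrow> sat M s p)"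

definition elem_embedding :: "('a \<Rightarrow> 'b) \<Rightarrow> 'a ostruct \<Rightarrow> 'b ostruct \<Rightarrow> bool" where
  "elem_embedding f M N \<longleftrightarrow>
     is_struct M \<and> is_struct N \<and> f ` universe M \<subseteq> universe N \<and>
     (\<forall>p s. range s \<subseteq> universe M \<longrightarrow> (sat M s p \<longleftrightarrow> sat N (f \<circ> s) p))"

definition elem_substruct :: "'a ostruct \<Rightarrow> 'a ostruct \<Rightarrow> bool" where
  "elem_substruct M N \<longleftrightarrow> universe M \<subseteq> universe N \<and> elem_embedding id M N"

definition isomorphic :: "'a ostruct \<Rightarrow> 'b ostruct \<Rightarrow> bool" where
  "isomorphic M N \<longleftrightarrow>
     (\<exists>f. bij_betw f (universe M) (universe N) \<and>
        (\<forall>a\<in>universe M. \<forall>b\<in>universe M. (a, b) \<in> lt M \<longleftrightarrow> (f a, f b) \<in> lt N))"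

section \<open>Dense linear orders with neither first nor last element\<close>

definition T_ord :: "fm set" where
  "T_ord = {
     All 0 (Neg (Less 0 0)),
     All 0 (All 1 (All 2 (Imp (Conj (Less 0 1) (Less 1 2)) (Less 0 2)))),
     All 0 (All 1 (Disj (Less 0 1) (Disj (Eq 0 1) (Less 1 0)))),
     All 0 (All 1 (Imp (Less 0 1) (Ex 2 (Conj (Less 0 2) (Less 2 1))))),
     All 0 (Ex 1 (Less 1 0)),
     All 0 (Ex 1 (Less 0 1))}"

lemma is_model_T_ord_iff:
  "is_model M T_ord \<longleftrightarrow>
     universe M \<noteq> {} \<and> lt M \<subseteq> universe M \<times> universe M \<and>
     irrefl (lt M) \<and> trans (lt M) \<and> total_on (universe M) (lt M) \<and>
     (\<forall>(a, b)\<in>lt M. \<exists>c. (a, c) \<in> lt M \<and> (c, b) \<in> lt M) \<and>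
     (\<forall>a\<in>universe M. \<exists>b. (b, a) \<in> lt M) \<and>
     (\<forall>a\<in>universe M. \<exists>b. (a, b) \<in> lt M)"
proof (cases "is_struct M")
  case True
  let ?U = "universe M" and ?R = "lt M"
  obtain a where "a \<in> ?U" and sub: "\<And>a b. (a, b) \<in> ?R \<Longrightarrow> a \<in> ?U \<and> b \<in> ?U"
    using True by (auto simp: is_struct_def)
  then have "\<exists>s :: nat \<Rightarrow> _. range s \<subseteq> ?U"
    by (intro exI[of _ "\<lambda>_. a"]) auto
  then have "is_model M T_ord \<longleftrightarrow>
      (\<forall>a\<in>?U. (a, a) \<notin> ?R) \<and>
      (\<forall>a\<in>?U. \<forall>b\<in>?U. (a, b) \<in> ?R \<longrightarrow> (\<forall>c\<in>?U. (b, c) \<in> ?R \<longrightarrow> (a, c) \<in> ?R)) \<and>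
      (\<forall>a\<in>?U. \<forall>b\<in>?U. (a, b) \<in> ?R \<or> a = b \<or> (b, a) \<in> ?R) \<and>
      (\<forall>a\<in>?U. \<forall>b\<in>?U. (a, b) \<in> ?R \<longrightarrow> (\<exists>c\<in>?U. (a, c) \<in> ?R \<and> (c, b) \<in> ?R)) \<and>
      (\<forall>a\<in>?U. \<exists>b\<in>?U. (b, a) \<in> ?R) \<and>
      (\<forall>a\<in>?U. \<exists>b\<in>?U. (a, b) \<in> ?R)"
    using True by (simp add: is_model_def T_ord_def)
  moreover have "(\<forall>a\<in>?U. (a, a) \<notin> ?R) \<longleftrightarrow> irrefl ?R"
    using sub by (auto simp: irrefl_def)
  moreover have "(\<forall>a\<in>?U. \<forall>b\<in>?U. (a, b) \<in> ?R \<longrightarrow>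
      (\<forall>c\<in>?U. (b, c) \<in> ?R \<longrightarrow> (a, c) \<in> ?R)) \<longleftrightarrow> trans ?R"
    unfolding trans_def using sub by meson
  moreover have "(\<forall>a\<in>?U. \<forall>b\<in>?U. (a, b) \<in> ?R \<or> a = b \<or> (b, a) \<in> ?R) \<longleftrightarrow>
      total_on ?U ?R"
    by (auto simp: total_on_def)
  moreover have "(\<forall>a\<in>?U. \<forall>b\<in>?U. (a, b) \<in> ?R \<longrightarrow> (\<exists>c\<in>?U. (a, c) \<in> ?R \<and> (c, b) \<in> ?R)) \<longleftrightarrow>
      (\<forall>(a, b)\<in>?R. \<exists>c. (a, c) \<in> ?R \<and> (c, b) \<in> ?R)"
    using sub by (force simp: split_beta)
  moreover have "(\<forall>a\<in>?U. \<exists>b\<in>?U. (b, a) \<in> ?R) \<longleftrightarrow> (\<forall>a\<in>?U. \<exists>b. (b, a) \<in> ?R)"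
    "(\<forall>a\<in>?U. \<exists>b\<in>?U. (a, b) \<in> ?R) \<longleftrightarrow> (\<forall>a\<in>?U. \<exists>b. (a, b) \<in> ?R)"
    using sub by meson+
  ultimately show ?thesis
    using True unfolding is_struct_def by argo
qed (auto simp: is_model_def is_struct_def)

section \<open>Cardinals and ordinals\<close>

text \<open>Cardinals are relations \<open>r\<close> with \<^term>\<open>Card_order r\<close>. The cardinal
  \<open>r^{<s}\<close> is the number of functions into \<open>r\<close> whose domain is a proper
  initial segment of \<open>s\<close>. The domain is recorded explicitly, since
  \<^const>\<open>Func\<close> consists of total functions.\<close>

definition cexp_less :: "'a rel \<Rightarrow> 'b rel \<Rightarrow> ('b \<times> ('b \<Rightarrow> 'a)) rel" where
  "cexp_less r s = |Sigma (Field s) (\<lambda>a. Func (underS s a) (Field r))|"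

text \<open>\<^term>\<open>has_cf r k\<close>: the well-order \<open>r\<close>, which must not have a last
  element, has cofinality \<open>k\<close>. (The \<^const>\<open>cofinal\<close> of the library demands
  strict upper bounds.)\<close>

definition has_cf :: "'a rel \<Rightarrow> 'b rel \<Rightarrow> bool" where
  "has_cf r k \<longleftrightarrow>
     (\<exists>A \<subseteq> Field r. cofinal A r \<and> |A| =o k) \<and>
     (\<forall>A \<subseteq> Field r. cofinal A r \<longrightarrow> k \<le>o |A| )"

text \<open>The ordinals below the order type of a well-order \<open>r\<close> are represented by
  the elements of \<^term>\<open>Field r\<close>; the ordinals below \<open>\<lambda>\<^sup>+\<close> are thus the
  elements of \<^term>\<open>Field (cardSuc l)\<close>.\<close>

definition is_limit :: "'a rel \<Rightarrow> 'a \<Rightarrow> bool" where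
  "is_limit r d \<longleftrightarrow>
     d \<in> Field r \<and> underS r d \<noteq> {} \<and> (\<forall>a\<in>underS r d. wo_rel.suc r {a} \<noteq> d)"

definition elem_inc_cont :: "'i rel \<Rightarrow> 'i \<Rightarrow> ('i \<Rightarrow> 'a ostruct) \<Rightarrow> bool" where
  "elem_inc_cont r d MM \<longleftrightarrow>
     (\<forall>a b. (a, b) \<in> r \<and> (b, d) \<in> r \<longrightarrow> elem_substruct (MM a) (MM b)) \<and>
     (\<forall>b. (b, d) \<in> r \<and> is_limit r b \<longrightarrow>
        universe (MM b) = (\<Union>a\<in>underS r b. universe (MM a)) \<and>
        lt (MM b) = (\<Union>a\<in>underS r b. lt (MM a)))"

section \<open>Superlimit models\<close>

text \<open>All structures below live on one type \<open>'a\<close>. As this type is arbitrary and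
  every structure of cardinality \<open>\<lambda>\<close>, and every chain of structures whose union has
  cardinality \<open>\<lambda>\<close>, has an isomorphic copy on any type with at least \<open>\<lambda>\<close>
  elements, this loses no generality.\<close>

definition EC :: "'l rel \<Rightarrow> fm set \<Rightarrow> 'a ostruct set" where
  "EC l T = {M. is_model M T \<and> |universe M| =o l}"

definition universal :: "'l rel \<Rightarrow> fm set \<Rightarrow> 'a ostruct \<Rightarrow> bool" where
  "universal l T M \<longleftrightarrow>
     is_model M T \<and> (\<forall>N :: 'a ostruct. N \<in> EC l T \<longrightarrow> (\<exists>f. elem_embedding f N M))"

definition superlimit :: "'l rel \<Rightarrow> 'k rel \<Rightarrow> fm set \<Rightarrow> 'a ostruct \<Rightarrow> bool" where
  "superlimit l k T M \<longleftrightarrow>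
     M \<in> EC l T \<and> universal l T M \<and>
     (\<forall>d (MM :: 'l set \<Rightarrow> 'a ostruct).
        is_limit (cardSuc l) d \<and>
        has_cf (Restr (cardSuc l) (underS (cardSuc l) d)) k \<and>
        elem_inc_cont (cardSuc l) d MM \<and>
        (\<forall>a\<in>underS (cardSuc l) d. isomorphic (MM (wo_rel.suc (cardSuc l) {a})) M)
        \<longrightarrow> isomorphic (MM d) M)"

end

theory Submission
  imports Defs
begin

text \<open>
  Suppose \<open>M\<close> is superlimit. Passing to unions, any increasing chain of \<open>\<kappa>\<close> copies of \<open>M\<close>,
  continuous or not, has a union isomorphic to \<open>M\<close>, and by universality each copy in such a
  chain may be chosen to contain any prescribed extension of size \<open>\<lambda>\<close> of the previous ones.
  Two choices contradict each other.

  If each step puts a new point immediately below every old one, then \<open>M = \<Union>\<^sub>i S\<^sub>i\<close> (\<open>i < \<kappa>\<close>)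
  where no point of \<open>M\<close> is a limit from below of any \<open>S\<^sub>i\<close>.

  On the other hand, let \<open>D\<close> be the lexicographic order on the functions \<open>\<kappa> \<rightarrow> \<kappa>\<close>; it has at
  most \<open>\<lambda>\<^bsup><\<lambda>\<^esup> = \<lambda>\<close> elements. One can build a chain starting from \<open>D\<close> such that from stage \<open>a\<close> on
  each cylinder \<open>[f|a] = {g \<in> D. g|a = f|a}\<close> has a least upper bound which stays its least upper
  bound in all later stages. Now choose \<open>f(a)\<close> by recursion on \<open>a\<close> such that no \<open>g \<in> S\<^sub>a\<close> agrees
  with \<open>f\<close> up to and including \<open>a\<close>. This is possible, since otherwise \<open>S\<^sub>a\<close> is cofinal below the
  least upper bound of \<open>[f|a]\<close>. Then \<open>f \<in> D\<close> lies in no \<open>S\<^sub>a\<close>.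

  To embed an order \<open>Y\<close> in \<open>M\<close> so that a given least upper bound is kept, split \<open>Y\<close> as an increasing
  union of sets \<open>T\<^sub>j\<close> (\<open>j < \<kappa>\<close>), none of which approaches the point from below, and embed
  \<open>T\<^sub>j\<close> in the \<open>j\<close>th member of a chain of copies of \<open>M\<close>: every new point is eventually
  overtaken by elements of \<open>Y\<close> that arrive later. Regularity of \<open>\<kappa>\<close> makes the \<open>T\<^sub>j\<close> exhaust \<open>Y\<close>.
\<close>

section \<open>Linear and dense linear orders as structures\<close>

text \<open>The universe may be empty, unlike in \<open>is_struct\<close>: the empty order serves as
  a base for chains.\<close>

definition lin :: "'a ostruct \<Rightarrow> bool" where
  "lin N \<longleftrightarrow> lt N \<subseteq> universe N \<times> universe N \<and> irrefl (lt N) \<and> trans (lt N) \<and>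
     total_on (universe N) (lt N)"

definition dlo :: "'a ostruct \<Rightarrow> bool" where
  "dlo N \<longleftrightarrow> lin N \<and> universe N \<noteq> {} \<and>
     (\<forall>a b. (a, b) \<in> lt N \<longrightarrow> (\<exists>c. (a, c) \<in> lt N \<and> (c, b) \<in> lt N)) \<and>
     (\<forall>a\<in>universe N. \<exists>b. (b, a) \<in> lt N) \<and>
     (\<forall>a\<in>universe N. \<exists>b. (a, b) \<in> lt N)"

text \<open>Between linear orders injectivity follows by trichotomy (\<open>ord_emb_inj\<close>). As
  the order is both preserved and reflected, \<open>substr\<close> means induced suborder.\<close>

definition ord_emb :: "('a \<Rightarrow> 'b) \<Rightarrow> 'a ostruct \<Rightarrow> 'b ostruct \<Rightarrow> bool" where
  "ord_emb f M N \<longleftrightarrow> f ` universe M \<subseteq> universe N \<and>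
     (\<forall>a\<in>universe M. \<forall>b\<in>universe M. (a, b) \<in> lt M \<longleftrightarrow> (f a, f b) \<in> lt N)"

abbreviation substr :: "'a ostruct \<Rightarrow> 'a ostruct \<Rightarrow> bool" where
  "substr \<equiv> ord_emb (\<lambda>x. x)"

definition union_struct :: "'i set \<Rightarrow> ('i \<Rightarrow> 'a ostruct) \<Rightarrow> 'a ostruct" where
  "union_struct I N = \<lparr>universe = (\<Union>i\<in>I. universe (N i)), lt = (\<Union>i\<in>I. lt (N i))\<rparr>"

lemma is_model_T_ord_iff_dlo: "is_model N T_ord \<longleftrightarrow> dlo N"
  unfolding is_model_T_ord_iff dlo_def lin_def by auto

lemma linI:
  assumes "\<And>x y. (x, y) \<in> lt N \<Longrightarrow> x \<in> universe N \<and> y \<in> universe N"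
    and "\<And>x. (x, x) \<notin> lt N"
    and "\<And>x y z. (x, y) \<in> lt N \<Longrightarrow> (y, z) \<in> lt N \<Longrightarrow> (x, z) \<in> lt N"
    and "\<And>x y. x \<in> universe N \<Longrightarrow> y \<in> universe N \<Longrightarrow> x \<noteq> y \<Longrightarrow> (x, y) \<in> lt N \<or> (y, x) \<in> lt N"
  shows "lin N"
  unfolding lin_def
proof (intro conjI)
  show "lt N \<subseteq> universe N \<times> universe N" using assms(1) by auto
  show "irrefl (lt N)" using assms(2) by (auto simp: irrefl_def)
  show "trans (lt N)" using assms(3) by (rule transI)
  show "total_on (universe N) (lt N)" using assms(4) by (auto simp: total_on_def)
qed

lemma lin_dom:
  assumes "lin N" "(x, y) \<in> lt N"
  shows "x \<in> universe N" "y \<in> universe N"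
  using assms unfolding lin_def by auto

lemma lin_irrefl: "lin N \<Longrightarrow> (x, x) \<notin> lt N"
  unfolding lin_def irrefl_def by auto

lemma lin_trans: "lin N \<Longrightarrow> (x, y) \<in> lt N \<Longrightarrow> (y, z) \<in> lt N \<Longrightarrow> (x, z) \<in> lt N"
  unfolding lin_def trans_def by blast

lemma lin_asym: "lin N \<Longrightarrow> (x, y) \<in> lt N \<Longrightarrow> (y, x) \<notin> lt N"
  using lin_trans lin_irrefl by metis

lemma lin_total:
  "lin N \<Longrightarrow> x \<in> universe N \<Longrightarrow> y \<in> universe N \<Longrightarrow> (x, y) \<in> lt N \<or> x = y \<or> (y, x) \<in> lt N"
  unfolding lin_def total_on_def by blast

lemma dlo_lin: "dlo N \<Longrightarrow> lin N"
  by (simp add: dlo_def)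

lemma ord_emb_mem: "ord_emb f M N \<Longrightarrow> x \<in> universe M \<Longrightarrow> f x \<in> universe N"
  unfolding ord_emb_def by blast

lemma ord_emb_less:
  "ord_emb f M N \<Longrightarrow> x \<in> universe M \<Longrightarrow> y \<in> universe M \<Longrightarrow> (f x, f y) \<in> lt N \<longleftrightarrow> (x, y) \<in> lt M"
  unfolding ord_emb_def by blast

lemma ord_emb_lessD: "ord_emb f M N \<Longrightarrow> lin M \<Longrightarrow> (x, y) \<in> lt M \<Longrightarrow> (f x, f y) \<in> lt N"
  using ord_emb_less lin_dom by metis

lemma ord_emb_inj:
  assumes "ord_emb f M N" "lin M" "lin N"
  shows "inj_on f (universe M)"
proof (rule inj_onI)
  fix x y assume xy: "x \<in> universe M" "y \<in> universe M" "f x = f y"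
  then have "(f x, f y) \<notin> lt N" "(f y, f x) \<notin> lt N"
    using lin_irrefl[OF assms(3)] by auto
  then show "x = y"
    using ord_emb_less[OF assms(1)] lin_total[OF assms(2)] xy by metis
qed

lemma ord_embI:
  assumes "lin M" "lin N" "\<And>x. x \<in> universe M \<Longrightarrow> f x \<in> universe N"
    and "\<And>x y. (x, y) \<in> lt M \<Longrightarrow> (f x, f y) \<in> lt N"
  shows "ord_emb f M N"
  unfolding ord_emb_def
proof (intro conjI ballI iffI)
  show "f ` universe M \<subseteq> universe N" using assms(3) by auto
next
  fix x y assume xy: "x \<in> universe M" "y \<in> universe M" and *: "(f x, f y) \<in> lt N"
  then show "(x, y) \<in> lt M"
    using lin_total[OF assms(1) xy] assms(4)[of y x] lin_asym[OF assms(2) *] lin_irrefl[OF assms(2)]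
    by auto
qed (use assms(4) in auto)

lemma ord_emb_comp: "ord_emb f M N \<Longrightarrow> ord_emb g N P \<Longrightarrow> ord_emb (\<lambda>x. g (f x)) M P"
  unfolding ord_emb_def by (auto simp: image_subset_iff)

lemma ord_emb_refl: "substr N N"
  unfolding ord_emb_def by auto

lemma lin_pullback:
  assumes "lin N" "inj_on f U" "f ` U \<subseteq> universe N"
  shows "lin \<lparr>universe = U, lt = {(x, y). x \<in> U \<and> y \<in> U \<and> (f x, f y) \<in> lt N}\<rparr>" (is "lin ?P")
    and "ord_emb f \<lparr>universe = U, lt = {(x, y). x \<in> U \<and> y \<in> U \<and> (f x, f y) \<in> lt N}\<rparr> N"
proof -
  show "lin ?P"
  proof (rule linI)
    fix x y assume "x \<in> universe ?P" "y \<in> universe ?P" "x \<noteq> y"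
    then show "(x, y) \<in> lt ?P \<or> (y, x) \<in> lt ?P"
      using lin_total[OF assms(1), of "f x" "f y"] assms(2,3) by (auto simp: inj_on_def)
  qed (use lin_irrefl[OF assms(1)] lin_trans[OF assms(1)] in auto)
  show "ord_emb f ?P N" using assms(3) by (auto simp: ord_emb_def)
qed

lemma isomorphicE:
  assumes "isomorphic M N"
  obtains f where "bij_betw f (universe M) (universe N)" "ord_emb f M N"
  using assms unfolding isomorphic_def ord_emb_def bij_betw_def by blast

lemma isomorphicI: "bij_betw f (universe M) (universe N) \<Longrightarrow> ord_emb f M N \<Longrightarrow> isomorphic M N"
  unfolding isomorphic_def ord_emb_def by blast

lemma isomorphic_sym:
  assumes "isomorphic M N"
  shows "isomorphic N M"
proof -
  obtain f where f: "bij_betw f (universe M) (universe N)" "ord_emb f M N"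
    using assms by (rule isomorphicE)
  let ?g = "inv_into (universe M) f"
  have g: "bij_betw ?g (universe N) (universe M)"
    using f(1) by (rule bij_betw_inv_into)
  have "(a, b) \<in> lt N \<longleftrightarrow> (?g a, ?g b) \<in> lt M" if "a \<in> universe N" "b \<in> universe N" for a b
    using ord_emb_less[OF f(2), of "?g a" "?g b"] that bij_betw_inv_into_right[OF f(1)]
      bij_betwE[OF g] by auto
  then have "ord_emb ?g N M"
    using g unfolding ord_emb_def bij_betw_def by blast
  then show ?thesis using g by (rule isomorphicI[rotated])
qed

lemma isomorphic_trans: "isomorphic M N \<Longrightarrow> isomorphic N P \<Longrightarrow> isomorphic M P"
  by (elim isomorphicE, rule isomorphicI[OF bij_betw_trans[unfolded comp_def]])
    (assumption, assumption, erule (1) ord_emb_comp)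

text \<open>\<open>isomorphic\<close> ignores pairs of \<open>lt M\<close> outside
  \<open>universe M\<close>. The hypothesis on \<open>lt M\<close> excludes such pairs, so that
  \<open>M\<close> is literally the pullback of \<open>N\<close> along the isomorphism.\<close>

lemma dlo_isomorphic:
  assumes N: "dlo N" and dom: "lt M \<subseteq> universe M \<times> universe M" and iso: "isomorphic M N"
  shows "dlo M"
proof -
  obtain f where f: "bij_betw f (universe M) (universe N)" "ord_emb f M N"
    using iso by (rule isomorphicE)
  note l = dlo_lin[OF N]
  have e: "\<And>a b. (a, b) \<in> lt M \<longleftrightarrow> a \<in> universe M \<and> b \<in> universe M \<and> (f a, f b) \<in> lt N"
    using f(2) dom unfolding ord_emb_def by blast
  have "M = \<lparr>universe = universe M,
      lt = {(x, y). x \<in> universe M \<and> y \<in> universe M \<and> (f x, f y) \<in> lt N}\<rparr>"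
    using e by (cases M) auto
  then have lin: "lin M"
    using lin_pullback(1)[OF l, of f "universe M"] f(1) unfolding bij_betw_def by simp
  have pre: "\<exists>a\<in>universe M. c = f a" if "(c, d) \<in> lt N \<or> (d, c) \<in> lt N" for c d
    using lin_dom[OF l] that f(1) unfolding bij_betw_def by blast
  have im: "\<And>a. a \<in> universe M \<Longrightarrow> f a \<in> universe N"
    using f(1) by (auto simp: bij_betw_def)
  show ?thesis
    unfolding dlo_def
  proof (intro conjI allI impI ballI)
    show "universe M \<noteq> {}" using N f(1) unfolding dlo_def bij_betw_def by auto
  next
    fix a b assume ab: "(a, b) \<in> lt M"
    then obtain c where "(f a, c) \<in> lt N" "(c, f b) \<in> lt N"
      using N e unfolding dlo_def by metis
    then show "\<exists>c. (a, c) \<in> lt M \<and> (c, b) \<in> lt M" using pre e ab by metis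
  next
    fix a assume a: "a \<in> universe M"
    then obtain c where "(c, f a) \<in> lt N" using N im unfolding dlo_def by metis
    then show "\<exists>b. (b, a) \<in> lt M" using pre e a by metis
  next
    fix a assume a: "a \<in> universe M"
    then obtain c where "(f a, c) \<in> lt N" using N im unfolding dlo_def by metis
    then show "\<exists>b. (a, b) \<in> lt M" using pre e a by metis
  qed (rule lin)
qed

section \<open>Directed unions\<close>

lemma union_struct_sel [simp]:
  "universe (union_struct I N) = (\<Union>i\<in>I. universe (N i))"
  "lt (union_struct I N) = (\<Union>i\<in>I. lt (N i))"
  by (simp_all add: union_struct_def)

lemma union_struct_cong: "(\<And>i. i \<in> I \<Longrightarrow> N i = N' i) \<Longrightarrow> union_struct I N = union_struct I N'"
  by (simp add: union_struct_def)

text \<open>Two points of \<open>N i\<close> that some \<open>N j\<close> compares are compared in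
  the same way by a common extension \<open>N k\<close>, which agrees with \<open>N i\<close> on
  them.\<close>

lemma substr_union:
  assumes dir: "\<And>i j. i \<in> I \<Longrightarrow> j \<in> I \<Longrightarrow> \<exists>k\<in>I. substr (N i) (N k) \<and> substr (N j) (N k)"
    and lin: "\<And>i. i \<in> I \<Longrightarrow> lin (N i)" and "i \<in> I"
  shows "substr (N i) (union_struct I N)"
  unfolding ord_emb_def
proof (intro conjI ballI iffI)
  fix a b assume ab: "a \<in> universe (N i)" "b \<in> universe (N i)" "(a, b) \<in> lt (union_struct I N)"
  then obtain j where j: "j \<in> I" "(a, b) \<in> lt (N j)" by auto
  then obtain k where k: "k \<in> I" "substr (N i) (N k)" "substr (N j) (N k)"
    using dir \<open>i \<in> I\<close> by blast
  then show "(a, b) \<in> lt (N i)"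
    using ord_emb_lessD[OF k(3) lin j(2)] j(1) ord_emb_less[OF k(2) ab(1,2)] by simp
qed (use \<open>i \<in> I\<close> in auto)

lemma lin_union:
  assumes dir: "\<And>i j. i \<in> I \<Longrightarrow> j \<in> I \<Longrightarrow> \<exists>k\<in>I. substr (N i) (N k) \<and> substr (N j) (N k)"
    and lin: "\<And>i. i \<in> I \<Longrightarrow> lin (N i)"
  shows "lin (union_struct I N)" (is "lin ?U")
proof -
  have two: "\<exists>k\<in>I. x \<in> universe (N k) \<and> y \<in> universe (N k)"
    if "x \<in> universe ?U" "y \<in> universe ?U" for x y
  proof -
    obtain i j where "i \<in> I" "j \<in> I" "x \<in> universe (N i)" "y \<in> universe (N j)"
      using \<open>x \<in> universe ?U\<close> \<open>y \<in> universe ?U\<close> by auto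
    then show ?thesis using dir[of i j] ord_emb_mem by metis
  qed
  note sub = substr_union[of I N, OF dir lin]
  have dom: "x \<in> universe ?U \<and> y \<in> universe ?U" if xy: "(x, y) \<in> lt ?U" for x y
  proof -
    obtain i where i: "i \<in> I" "(x, y) \<in> lt (N i)" using xy by auto
    then show ?thesis using lin_dom[OF lin[OF i(1)] i(2)] by auto
  qed
  show ?thesis
  proof (rule linI)
    show "(x, x) \<notin> lt ?U" for x using lin_irrefl[OF lin] by auto
    fix x y z
    show "(x, z) \<in> lt ?U" if xy: "(x, y) \<in> lt ?U" and yz: "(y, z) \<in> lt ?U"
    proof -
      obtain i j where ij: "i \<in> I" "j \<in> I" "(x, y) \<in> lt (N i)" "(y, z) \<in> lt (N j)"
        using xy yz by auto
      then obtain k where k: "k \<in> I" "substr (N i) (N k)" "substr (N j) (N k)"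
        using dir by blast
      have "(x, z) \<in> lt (N k)"
        using lin_trans[OF lin[OF k(1)] ord_emb_lessD[OF k(2) lin] ord_emb_lessD[OF k(3) lin]] ij
        by blast
      then show ?thesis using k(1) by auto
    qed
    show "(x, y) \<in> lt ?U \<or> (y, x) \<in> lt ?U"
      if xy: "x \<in> universe ?U" "y \<in> universe ?U" "x \<noteq> y"
    proof -
      obtain k where k: "k \<in> I" "x \<in> universe (N k)" "y \<in> universe (N k)"
        using two xy by blast
      then show ?thesis using lin_total[OF lin[OF k(1)] k(2,3)] xy(3) by auto
    qed
  qed (use dom in blast)
qed

lemma dlo_union:
  assumes dir: "\<And>i j. i \<in> I \<Longrightarrow> j \<in> I \<Longrightarrow> \<exists>k\<in>I. substr (N i) (N k) \<and> substr (N j) (N k)"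
    and dlo: "\<And>i. i \<in> I \<Longrightarrow> dlo (N i)" and "I \<noteq> {}"
  shows "dlo (union_struct I N)"
  unfolding dlo_def
proof (intro conjI allI impI ballI)
  show "lin (union_struct I N)" by (rule lin_union[OF dir dlo_lin[OF dlo]])
  show "universe (union_struct I N) \<noteq> {}"
    using dlo \<open>I \<noteq> {}\<close> by (auto simp: dlo_def)
next
  fix a b assume "(a, b) \<in> lt (union_struct I N)"
  then obtain i where "i \<in> I" "(a, b) \<in> lt (N i)" by auto
  then show "\<exists>c. (a, c) \<in> lt (union_struct I N) \<and> (c, b) \<in> lt (union_struct I N)"
    using dlo[of i] unfolding dlo_def by fastforce
next
  fix a assume "a \<in> universe (union_struct I N)"
  then obtain i where "i \<in> I" "a \<in> universe (N i)" by auto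
  then show "\<exists>b. (b, a) \<in> lt (union_struct I N)" "\<exists>b. (a, b) \<in> lt (union_struct I N)"
    using dlo[of i] unfolding dlo_def by fastforce+
qed

section \<open>Embeddings between dense linear orders are elementary\<close>

text \<open>Bound variables are included, so that one finite set \<open>V\<close> serves a formula
  and all its subformulas in the induction of \<open>sat_same_order\<close>.\<close>

primrec fm_vars :: "fm \<Rightarrow> nat set" where
  "fm_vars (Eq x y) = {x, y}"
| "fm_vars (Less x y) = {x, y}"
| "fm_vars (Neg p) = fm_vars p"
| "fm_vars (Conj p q) = fm_vars p \<union> fm_vars q"
| "fm_vars (Ex x p) = insert x (fm_vars p)"

lemma finite_fm_vars: "finite (fm_vars p)"
  by (induction p) auto

text \<open>Only the maximum of \<open>A\<close> and the minimum of \<open>B\<close> matter: density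
  separates them. If one set is empty, the lack of endpoints replaces density; if both are, any
  point will do.\<close>

lemma dlo_betw:
  assumes N: "dlo N" and fin: "finite A" "finite B"
    and sub: "A \<subseteq> universe N" "B \<subseteq> universe N"
    and AB: "\<And>a b. a \<in> A \<Longrightarrow> b \<in> B \<Longrightarrow> (a, b) \<in> lt N"
  shows "\<exists>c\<in>universe N. (\<forall>a\<in>A. (a, c) \<in> lt N) \<and> (\<forall>b\<in>B. (c, b) \<in> lt N)"
proof -
  note l = dlo_lin[OF N]
  have mx: "\<exists>m\<in>A. \<forall>a\<in>A. a = m \<or> (a, m) \<in> lt N" if "finite A" "A \<noteq> {}" "A \<subseteq> universe N" for A
    using that
  proof (induction rule: finite_ne_induct)
    case (insert x F)
    then obtain m where m: "m \<in> F" "\<forall>a\<in>F. a = m \<or> (a, m) \<in> lt N" by auto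
    have x: "x \<in> universe N" "m \<in> universe N" using insert.prems m(1) by auto
    show ?case
    proof (cases "(m, x) \<in> lt N")
      case True
      then have "\<forall>a\<in>F. (a, x) \<in> lt N" using m(2) lin_trans[OF l] by metis
      then show ?thesis by auto
    next
      case False
      then show ?thesis using m lin_total[OF l x] by auto
    qed
  qed auto
  have mn: "\<exists>m\<in>A. \<forall>a\<in>A. a = m \<or> (m, a) \<in> lt N" if "finite A" "A \<noteq> {}" "A \<subseteq> universe N" for A
    using that
  proof (induction rule: finite_ne_induct)
    case (insert x F)
    then obtain m where m: "m \<in> F" "\<forall>a\<in>F. a = m \<or> (m, a) \<in> lt N" by auto
    have x: "x \<in> universe N" "m \<in> universe N" using insert.prems m(1) by auto
    show ?case
    proof (cases "(x, m) \<in> lt N")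
      case True
      then have "\<forall>a\<in>F. (x, a) \<in> lt N" using m(2) lin_trans[OF l] by metis
      then show ?thesis by auto
    next
      case False
      then show ?thesis using m lin_total[OF l x] by auto
    qed
  qed auto
  consider "A = {}" "B = {}" | "A = {}" "B \<noteq> {}" | "A \<noteq> {}" "B = {}" | "A \<noteq> {}" "B \<noteq> {}"
    by blast
  then show ?thesis
  proof cases
    case 1 then show ?thesis using N by (auto simp: dlo_def)
  next
    case 2
    then obtain m where m: "m \<in> B" "\<forall>a\<in>B. a = m \<or> (m, a) \<in> lt N" using mn[OF fin(2) 2(2) sub(2)] by blast
    have "m \<in> universe N" using m(1) sub by blast
    then obtain c where c: "(c, m) \<in> lt N" using N unfolding dlo_def by blast
    have "\<forall>b\<in>B. (c, b) \<in> lt N" using m(2) c lin_trans[OF l c] by auto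
    then show ?thesis using 2 lin_dom[OF l c] by auto
  next
    case 3
    then obtain m where m: "m \<in> A" "\<forall>a\<in>A. a = m \<or> (a, m) \<in> lt N" using mx[OF fin(1) 3(1) sub(1)] by blast
    have "m \<in> universe N" using m(1) sub by blast
    then obtain c where c: "(m, c) \<in> lt N" using N unfolding dlo_def by blast
    have "\<forall>a\<in>A. (a, c) \<in> lt N" using m(2) c lin_trans[OF l _ c] by auto
    then show ?thesis using 3 lin_dom[OF l c] by auto
  next
    case 4
    then obtain m where m: "m \<in> A" "\<forall>a\<in>A. a = m \<or> (a, m) \<in> lt N" using mx[OF fin(1) 4(1) sub(1)] by blast
    from 4 obtain n where n: "n \<in> B" "\<forall>a\<in>B. a = n \<or> (n, a) \<in> lt N" using mn[OF fin(2) 4(2) sub(2)] by blast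
    obtain c where c: "(m, c) \<in> lt N" "(c, n) \<in> lt N"
      using N AB[OF m(1) n(1)] unfolding dlo_def by blast
    have "\<forall>a\<in>A. (a, c) \<in> lt N" using m(2) c lin_trans[OF l _ c(1)] by auto
    moreover have "\<forall>b\<in>B. (c, b) \<in> lt N" using n(2) c lin_trans[OF l c(2)] by auto
    ultimately show ?thesis using lin_dom[OF l c(1)] by auto
  qed
qed

text \<open>A partial isomorphism in terms of assignments: the map from \<open>s x\<close> to
  \<open>t x\<close> for \<open>x\<close> in \<open>V\<close>. The clause on equality makes it well
  defined and injective.\<close>

definition same_order ::
    "nat set \<Rightarrow> 'a ostruct \<Rightarrow> (nat \<Rightarrow> 'a) \<Rightarrow> 'b ostruct \<Rightarrow> (nat \<Rightarrow> 'b) \<Rightarrow> bool" where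
  "same_order V M s N t \<longleftrightarrow> (\<forall>x\<in>V. \<forall>y\<in>V.
     ((s x, s y) \<in> lt M \<longleftrightarrow> (t x, t y) \<in> lt N) \<and> (s x = s y \<longleftrightarrow> t x = t y))"

lemma same_order_sym: "same_order V M s N t \<Longrightarrow> same_order V N t M s"
  unfolding same_order_def by blast

text \<open>The one-point extension step of the back-and-forth argument.\<close>

lemma same_order_extend:
  assumes M: "dlo M" and N: "dlo N" and V: "finite V"
    and s: "range s \<subseteq> universe M" and t: "range t \<subseteq> universe N"
    and so: "same_order V M s N t" and a: "a \<in> universe M"
  shows "\<exists>b\<in>universe N. same_order V M (s(x := a)) N (t(x := b))"
proof -
  note lM = dlo_lin[OF M] and lN = dlo_lin[OF N]
  \<comment> \<open>The old value at \<open>x\<close> is overwritten, so only the other variables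
    constrain the new point.\<close>
  let ?V = "V - {x}"
  have "\<exists>b\<in>universe N. \<forall>y\<in>?V. ((s y, a) \<in> lt M \<longleftrightarrow> (t y, b) \<in> lt N) \<and>
      ((a, s y) \<in> lt M \<longleftrightarrow> (b, t y) \<in> lt N) \<and> (s y = a \<longleftrightarrow> t y = b)"
  proof (cases "\<exists>z\<in>?V. s z = a")
    case True
    then obtain z where z: "z \<in> ?V" "s z = a" by blast
    have "t z \<in> universe N" using t by auto
    moreover have "\<forall>y\<in>?V. ((s y, a) \<in> lt M \<longleftrightarrow> (t y, t z) \<in> lt N) \<and>
      ((a, s y) \<in> lt M \<longleftrightarrow> (t z, t y) \<in> lt N) \<and> (s y = a \<longleftrightarrow> t y = t z)"
      using so z unfolding same_order_def by auto
    ultimately show ?thesis by blast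
  next
    case False
    \<comment> \<open>The new point must realise the cut of \<open>a\<close>: above the images of
      the values below \<open>a\<close>, and below the images of those above it.\<close>
    let ?A = "t ` {y\<in>?V. (s y, a) \<in> lt M}" and ?B = "t ` {y\<in>?V. (a, s y) \<in> lt M}"
    have "\<exists>b\<in>universe N. (\<forall>c\<in>?A. (c, b) \<in> lt N) \<and> (\<forall>c\<in>?B. (b, c) \<in> lt N)"
    proof (rule dlo_betw[OF N])
      fix c d assume "c \<in> ?A" "d \<in> ?B"
      then obtain y z where yz: "y \<in> ?V" "z \<in> ?V" "c = t y" "d = t z"
        "(s y, a) \<in> lt M" "(a, s z) \<in> lt M" by auto
      then have "(s y, s z) \<in> lt M" using lin_trans[OF lM] by blast
      then show "(c, d) \<in> lt N" using so yz unfolding same_order_def by blast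
    qed (use V t in auto)
    then obtain b where b: "b \<in> universe N" "\<forall>c\<in>?A. (c, b) \<in> lt N" "\<forall>c\<in>?B. (b, c) \<in> lt N"
      by blast
    have "((s y, a) \<in> lt M \<longleftrightarrow> (t y, b) \<in> lt N) \<and>
      ((a, s y) \<in> lt M \<longleftrightarrow> (b, t y) \<in> lt N) \<and> (s y = a \<longleftrightarrow> t y = b)" if y: "y \<in> ?V" for y
    proof -
      have "s y \<in> universe M" using s by auto
      then consider "(s y, a) \<in> lt M" | "(a, s y) \<in> lt M"
        using lin_total[OF lM _ a, of "s y"] y False by blast
      then show ?thesis
      proof cases
        case 1
        then have "(t y, b) \<in> lt N" using b(2) y by blast
        then show ?thesis using 1 lin_asym[OF lM 1] lin_asym[OF lN] lin_irrefl lM lN by metis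
      next
        case 2
        then have "(b, t y) \<in> lt N" using b(3) y by blast
        then show ?thesis using 2 lin_asym[OF lM 2] lin_asym[OF lN] lin_irrefl lM lN by metis
      qed
    qed
    then show ?thesis using b(1) by blast
  qed
  then obtain b where b: "b \<in> universe N" "\<forall>y\<in>?V. ((s y, a) \<in> lt M \<longleftrightarrow> (t y, b) \<in> lt N) \<and>
      ((a, s y) \<in> lt M \<longleftrightarrow> (b, t y) \<in> lt N) \<and> (s y = a \<longleftrightarrow> t y = b)"
    by blast
  have "same_order V M (s(x := a)) N (t(x := b))"
    unfolding same_order_def
  proof (intro ballI)
    fix y z assume "y \<in> V" "z \<in> V"
    then show "(((s(x := a)) y, (s(x := a)) z) \<in> lt M \<longleftrightarrow> ((t(x := b)) y, (t(x := b)) z) \<in> lt N) \<and>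
       ((s(x := a)) y = (s(x := a)) z \<longleftrightarrow> (t(x := b)) y = (t(x := b)) z)"
      using so b(2) lin_irrefl[OF lM] lin_irrefl[OF lN] unfolding same_order_def
      by (cases "y = x"; cases "z = x") auto
  qed
  then show ?thesis using b(1) by blast
qed

text \<open>Induction on the formula. At a quantifier, a witness on either side is matched by
  \<open>same_order_extend\<close>, used in both directions by symmetry.\<close>

lemma sat_same_order:
  assumes M: "dlo M" and N: "dlo N" and V: "finite V"
  shows "fm_vars p \<subseteq> V \<Longrightarrow> range s \<subseteq> universe M \<Longrightarrow> range t \<subseteq> universe N \<Longrightarrow>
    same_order V M s N t \<Longrightarrow> sat M s p \<longleftrightarrow> sat N t p"
proof (induction p arbitrary: s t)
  case (Ex x p)
  have IH: "\<And>a b. a \<in> universe M \<Longrightarrow> b \<in> universe N \<Longrightarrow>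
      same_order V M (s(x := a)) N (t(x := b)) \<Longrightarrow> sat M (s(x := a)) p \<longleftrightarrow> sat N (t(x := b)) p"
    using Ex.prems by (intro Ex.IH) (auto simp: image_subset_iff simp del: fun_upd_apply, auto)
  show ?case
  proof
    assume "sat M s (fm.Ex x p)"
    then obtain a where a: "a \<in> universe M" "sat M (s(x := a)) p" by auto
    then obtain b where "b \<in> universe N" "same_order V M (s(x := a)) N (t(x := b))"
      using same_order_extend[OF M N V Ex.prems(2-4)] by blast
    then show "sat N t (fm.Ex x p)" using IH a by auto
  next
    assume "sat N t (fm.Ex x p)"
    then obtain a where a: "a \<in> universe N" "sat N (t(x := a)) p" by auto
    then obtain b where "b \<in> universe M" "same_order V N (t(x := a)) M (s(x := b))"
      using same_order_extend[OF N M V Ex.prems(3,2) same_order_sym[OF Ex.prems(4)]] by blast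
    then have "b \<in> universe M" "sat M (s(x := b)) p"
      using IH[OF _ a(1) same_order_sym] a(2) by blast+
    then show "sat M s (fm.Ex x p)" by auto
  qed
next
  case (Conj p q)
  then have "sat M s p \<longleftrightarrow> sat N t p" "sat M s q \<longleftrightarrow> sat N t q" by auto
  then show ?case by simp
qed (auto simp: same_order_def)

text \<open>Model completeness of \<open>T_ord\<close>: an assignment into \<open>M\<close> has the
  same order pattern in \<open>M\<close> and in \<open>N\<close>. Chains therefore only have to be
  increasing as orders.\<close>

lemma elem_substruct_dlo:
  assumes M: "dlo M" and N: "dlo N" and sub: "substr M N"
  shows "elem_substruct M N"
proof -
  have "sat M s p \<longleftrightarrow> sat N s p" if s: "range s \<subseteq> universe M" for p s
  proof (rule sat_same_order[OF M N finite_fm_vars[of p]])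
    show "range s \<subseteq> universe N" using s sub unfolding ord_emb_def by auto
    show "same_order (fm_vars p) M s N s"
      using s sub unfolding same_order_def ord_emb_def by (simp add: range_subsetD)
  qed (use s in auto)
  then show ?thesis
    using M N sub unfolding elem_substruct_def elem_embedding_def is_struct_def dlo_def lin_def
      ord_emb_def by auto
qed

lemma elem_embedding_ord_emb:
  assumes "elem_embedding f M N"
  shows "ord_emb f M N"
  unfolding ord_emb_def
proof (intro conjI ballI)
  show "f ` universe M \<subseteq> universe N" using assms by (simp add: elem_embedding_def)
  fix a b assume ab: "a \<in> universe M" "b \<in> universe M"
  let ?s = "\<lambda>n::nat. if n = 0 then a else b"
  have "range ?s \<subseteq> universe M" using ab by auto
  then have "sat M ?s (Less 0 1) \<longleftrightarrow> sat N (f \<circ> ?s) (Less 0 1)"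
    using assms unfolding elem_embedding_def by blast
  then show "(a, b) \<in> lt M \<longleftrightarrow> (f a, f b) \<in> lt N" by simp
qed

section \<open>Universality and chains\<close>

lemma union_struct_max:
  assumes "i \<in> I" "\<And>j. j \<in> I \<Longrightarrow> lin (N j)" "\<And>j. j \<in> I \<Longrightarrow> substr (N j) (N i)"
  shows "union_struct I N = N i"
proof -
  have "(\<Union>j\<in>I. universe (N j)) = universe (N i)"
    using assms(1,3) ord_emb_mem by fastforce
  moreover have "(\<Union>j\<in>I. lt (N j)) = lt (N i)"
    using assms ord_emb_lessD by fastforce
  ultimately show ?thesis by (simp add: union_struct_def)
qed

text \<open>Turns an embedding of an extension \<open>Y\<close> of \<open>W\<close> into an actual
  inclusion: the points \<open>G (e w)\<close> of \<open>M\<close> get back their names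
  \<open>w\<close>, all others get fresh names from \<open>V\<close>. The result is a copy of
  \<open>M\<close> that contains \<open>W\<close>.\<close>

lemma transport:
  fixes M :: "'a ostruct" and Y :: "'y ostruct" and W :: "'b ostruct"
  assumes lin: "lin M" "lin Y" "lin W" and G: "ord_emb G Y M" and e: "ord_emb e W Y"
    and V: "V \<inter> universe W = {}" "|universe M| \<le>o |V|"
  obtains N \<phi> where "bij_betw \<phi> (universe M) (universe N)" "ord_emb \<phi> M N" "lin N"
    "\<And>w. w \<in> universe W \<Longrightarrow> \<phi> (G (e w)) = w" "universe N \<subseteq> universe W \<union> V" "substr W N"
proof -
  obtain h where h: "inj_on h (universe M)" "h ` universe M \<subseteq> V"
    using V(2) card_of_ordLeq[of "universe M" V] by blast
  let ?g = "\<lambda>w. G (e w)"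
  have g: "ord_emb ?g W M" by (rule ord_emb_comp[OF e G])
  have gi: "inj_on ?g (universe W)" by (rule ord_emb_inj[OF g lin(3,1)])
  define \<phi> where "\<phi> m = (if m \<in> ?g ` universe W then inv_into (universe W) ?g m else h m)" for m
  have \<phi>g: "\<phi> (?g w) = w" if "w \<in> universe W" for w
    using that inv_into_f_f[OF gi that] by (simp add: \<phi>_def)
  have \<phi>h: "\<phi> m \<in> V" if "m \<in> universe M" "m \<notin> ?g ` universe W" for m
    using that h(2) by (auto simp: \<phi>_def)
  have \<phi>W: "\<phi> m \<in> universe W" if "m \<in> ?g ` universe W" for m
    using that \<phi>g by auto
  have inj: "inj_on \<phi> (universe M)"
  proof (rule inj_onI)
    fix a b assume ab: "a \<in> universe M" "b \<in> universe M" "\<phi> a = \<phi> b"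
    show "a = b"
    proof (cases "a \<in> ?g ` universe W")
      case True
      then have "b \<in> ?g ` universe W" using \<phi>h[OF ab(2)] \<phi>W[OF True] ab(3) V(1) by auto
      then show ?thesis using True ab(3) \<phi>g by auto
    next
      case False
      then have "b \<notin> ?g ` universe W" using \<phi>h[OF ab(1) False] \<phi>W ab(3) V(1) by auto
      then show ?thesis using False ab h(1) by (auto simp: \<phi>_def inj_on_def)
    qed
  qed
  \<comment> \<open>The order of \<open>N\<close> is pulled back along this inverse, which makes
    \<open>\<phi>\<close> an isomorphism by construction.\<close>
  define \<psi> where "\<psi> = inv_into (universe M) \<phi>"
  have \<psi>\<phi>: "\<And>m. m \<in> universe M \<Longrightarrow> \<psi> (\<phi> m) = m" using inj by (simp add: \<psi>_def)
  define N where "N = \<lparr>universe = \<phi> ` universe M,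
    lt = {(x, y). x \<in> \<phi> ` universe M \<and> y \<in> \<phi> ` universe M \<and> (\<psi> x, \<psi> y) \<in> lt M}\<rparr>"
  have linN: "lin N" unfolding N_def
    by (rule lin_pullback(1)[OF lin(1)]) (use \<psi>\<phi> in \<open>auto simp: inj_on_def\<close>)
  have emb: "ord_emb \<phi> M N" using \<psi>\<phi> by (auto simp: ord_emb_def N_def)
  show thesis
  proof (rule that)
    show "bij_betw \<phi> (universe M) (universe N)" using inj by (simp add: bij_betw_def N_def)
    show "universe N \<subseteq> universe W \<union> V" using \<phi>h \<phi>W by (auto simp: N_def)
    show "substr W N"
    proof (rule ord_embI[OF lin(3) linN])
      show "x \<in> universe N" if "x \<in> universe W" for x
        using ord_emb_mem[OF emb ord_emb_mem[OF g that]] \<phi>g that by simp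
      show "(x, y) \<in> lt N" if "(x, y) \<in> lt W" for x y
        using ord_emb_lessD[OF emb lin(1) ord_emb_lessD[OF g lin(3) that]] \<phi>g
          lin_dom[OF lin(3) that] by simp
    qed
  qed (use emb linN \<phi>g in auto)
qed

definition image_struct :: "('a \<Rightarrow> 'b) \<Rightarrow> 'a ostruct \<Rightarrow> 'b ostruct" where
  "image_struct f N = \<lparr>universe = f ` universe N, lt = map_prod f f ` lt N\<rparr>"

lemma image_struct_less:
  assumes "lin N" "inj_on f (universe N)" "x \<in> universe N" "y \<in> universe N"
  shows "(f x, f y) \<in> lt (image_struct f N) \<longleftrightarrow> (x, y) \<in> lt N"
proof
  assume "(f x, f y) \<in> lt (image_struct f N)"
  then obtain a b where ab: "(a, b) \<in> lt N" "f x = f a" "f y = f b"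
    by (auto simp: image_struct_def)
  then have "x = a" "y = b"
    using assms(2-4) lin_dom[OF assms(1) ab(1)] by (auto dest: inj_onD)
  then show "(x, y) \<in> lt N" using ab(1) by simp
qed (force simp: image_struct_def)

lemma isomorphic_image_struct:
  assumes "lin N" "inj_on f (universe N)"
  shows "isomorphic (image_struct f N) N"
proof -
  have "ord_emb f N (image_struct f N)"
    using image_struct_less[OF assms] by (simp add: ord_emb_def) (simp add: image_struct_def)
  moreover have "bij_betw f (universe N) (universe (image_struct f N))"
    using assms(2) by (simp add: bij_betw_def image_struct_def)
  ultimately show ?thesis using isomorphicI isomorphic_sym by blast
qed

lemma lin_image_struct:
  assumes "lin N" "inj_on f (universe N)"
  shows "lin (image_struct f N)"
proof (rule linI)
  have pre: "\<exists>a\<in>universe N. x = f a" if "x \<in> universe (image_struct f N)" for x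
    using that by (auto simp: image_struct_def)
  show dom: "x \<in> universe (image_struct f N) \<and> y \<in> universe (image_struct f N)"
    if "(x, y) \<in> lt (image_struct f N)" for x y
    using that lin_dom[OF assms(1)] by (auto simp: image_struct_def)
  note less = image_struct_less[OF assms]
  show "(x, x) \<notin> lt (image_struct f N)" for x
    using pre dom less lin_irrefl[OF assms(1)] by metis
  show "(x, z) \<in> lt (image_struct f N)"
    if xy: "(x, y) \<in> lt (image_struct f N)" and yz: "(y, z) \<in> lt (image_struct f N)" for x y z
  proof -
    obtain a b c where "a \<in> universe N" "x = f a" "b \<in> universe N" "y = f b" "c \<in> universe N" "z = f c"
      using dom[OF xy] dom[OF yz] pre by metis
    then show ?thesis using xy yz less lin_trans[OF assms(1)] by metis
  qed
  show "(x, y) \<in> lt (image_struct f N) \<or> (y, x) \<in> lt (image_struct f N)"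
    if "x \<in> universe (image_struct f N)" "y \<in> universe (image_struct f N)" "x \<noteq> y" for x y
    using that pre less lin_total[OF assms(1)] by metis
qed

section \<open>Universality of a fixed superlimit model for linear orders\<close>

locale superlimit_order =
  fixes l :: "'l rel" and k :: "'k rel" and M :: "'a ostruct"
  assumes l: "Card_order l" "cinfinite l" and k: "Card_order k" "cinfinite k"
    and kl: "k <o l" and reg: "regularCard k" and M: "superlimit l k T_ord M"
begin

lemma M_dlo: "dlo M" and M_card: "|universe M| =o l"
  using M unfolding superlimit_def EC_def by (auto simp: is_model_T_ord_iff_dlo)

lemma M_lin: "lin M"
  using M_dlo by (rule dlo_lin)

lemma infinite_M: "infinite (universe M)"
proof
  assume "finite (universe M)"
  then have "finite (Field l)" using card_of_Field_ordIso[OF l(1)] M_card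
    by (meson card_of_ordIso_finite ordIso_symmetric ordIso_transitive)
  then show False using l(2) by (simp add: cinfinite_def)
qed

lemma le_M: "|A| \<le>o l \<Longrightarrow> |A| \<le>o |universe M|"
  using M_card ordIso_symmetric ordLeq_ordIso_trans by blast

text \<open>
  Universality only speaks about models of size \<open>\<lambda>\<close>, so replace every point of \<open>Y\<close> by a copy of \<open>M\<close>.
\<close>

lemma lin_embeds:
  fixes Y :: "'y ostruct"
  assumes Y: "lin Y" and card: "|universe Y| \<le>o l"
  obtains g where "ord_emb g Y M"
proof (cases "universe Y = {}")
  case True
  then show ?thesis using that[of undefined] by (simp add: ord_emb_def)
next
  case False
  define P :: "('y \<times> 'a) ostruct" where "P = \<lparr>universe = universe Y \<times> universe M,
    lt = {(p, q). p \<in> universe Y \<times> universe M \<and> q \<in> universe Y \<times> universe M \<and>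
      ((fst p, fst q) \<in> lt Y \<or> fst p = fst q \<and> (snd p, snd q) \<in> lt M)}\<rparr>"
  have Psel: "universe P = universe Y \<times> universe M"
    "\<And>x m y n. ((x, m), (y, n)) \<in> lt P \<longleftrightarrow> x \<in> universe Y \<and> m \<in> universe M \<and> y \<in> universe Y \<and>
      n \<in> universe M \<and> ((x, y) \<in> lt Y \<or> x = y \<and> (m, n) \<in> lt M)"
    by (auto simp: P_def)
  have "lin P"
  proof (rule linI)
    fix p q assume "p \<in> universe P" "q \<in> universe P" "p \<noteq> q"
    then show "(p, q) \<in> lt P \<or> (q, p) \<in> lt P"
      using lin_total[OF Y, of "fst p" "fst q"] lin_total[OF M_lin, of "snd p" "snd q"]
      by (cases p; cases q) (auto simp: Psel)
  next
    fix p q r assume "(p, q) \<in> lt P" "(q, r) \<in> lt P"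
    then show "(p, r) \<in> lt P"
      using lin_trans[OF Y, of "fst p" "fst q" "fst r"] lin_trans[OF M_lin, of "snd p" "snd q" "snd r"]
      by (cases p; cases q; cases r) (auto simp: Psel)
  qed (use lin_irrefl[OF Y] lin_irrefl[OF M_lin] in \<open>auto simp: P_def\<close>)
  have "dlo P"
    unfolding dlo_def
  proof (intro conjI allI impI ballI)
    show "lin P" by fact
    show "universe P \<noteq> {}" using False M_dlo by (simp add: Psel dlo_def)
  next
    fix p q assume pq: "(p, q) \<in> lt P"
    obtain x m y n where p: "p = (x, m)" and q: "q = (y, n)" by fastforce
    show "\<exists>r. (p, r) \<in> lt P \<and> (r, q) \<in> lt P"
    \<comment> \<open>Two points of the same copy are separated inside it. Otherwise a point above
      \<open>p\<close> in the copy of \<open>p\<close> works, as \<open>M\<close> has no last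
      element.\<close>
    proof (cases "x = y")
      case True
      then have "(m, n) \<in> lt M" using pq p q lin_irrefl[OF Y] by (auto simp: Psel)
      then obtain c where "(m, c) \<in> lt M" "(c, n) \<in> lt M" using M_dlo unfolding dlo_def by blast
      then have "(p, (x, c)) \<in> lt P \<and> ((x, c), q) \<in> lt P"
        using pq p q True lin_dom[OF M_lin] by (auto simp: Psel)
      then show ?thesis by blast
    next
      case False
      have "m \<in> universe M" using pq p q by (auto simp: Psel)
      then obtain c where "(m, c) \<in> lt M" using M_dlo unfolding dlo_def by blast
      then have "(p, (x, c)) \<in> lt P \<and> ((x, c), q) \<in> lt P"
        using pq p q False lin_dom[OF M_lin] by (auto simp: Psel)
      then show ?thesis by blast
    qed
  next
    fix p assume p: "p \<in> universe P"
    obtain x m where xm: "p = (x, m)" by fastforce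
    then have m: "m \<in> universe M" "x \<in> universe Y" using p by (auto simp: Psel)
    then obtain c where "(m, c) \<in> lt M" using M_dlo unfolding dlo_def by blast
    then have "(p, (x, c)) \<in> lt P" using m xm lin_dom[OF M_lin] by (auto simp: Psel)
    then show "\<exists>q. (p, q) \<in> lt P" by blast
    obtain c where "(c, m) \<in> lt M" using m M_dlo unfolding dlo_def by blast
    then have "((x, c), p) \<in> lt P" using m xm lin_dom[OF M_lin] by (auto simp: Psel)
    then show "\<exists>q. (q, p) \<in> lt P" by blast
  qed
  have "|universe M| =o |universe P|"
    using card_of_Times_infinite[OF infinite_M False le_M[OF card]] ordIso_symmetric
    unfolding Psel by blast
  \<comment> \<open>\<open>universal\<close> quantifies only over structures on \<open>'a\<close>,
    so \<open>P\<close> is copied onto \<open>universe M\<close>, which has the right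
    cardinality.\<close>
  then obtain h where h: "bij_betw h (universe M) (universe P)"
    using card_of_ordIso by blast
  define N where "N = \<lparr>universe = universe M,
    lt = {(x, y). x \<in> universe M \<and> y \<in> universe M \<and> (h x, h y) \<in> lt P}\<rparr>"
  have hN: "ord_emb h N P" and linN: "lin N"
    unfolding N_def using lin_pullback[OF \<open>lin P\<close>, of h "universe M"] h by (auto simp: bij_betw_def)
  have isoNP: "isomorphic N P" using h hN by (intro isomorphicI[of h]) (simp_all add: N_def)
  have "dlo N" using dlo_isomorphic[OF \<open>dlo P\<close> _ isoNP] linN by (simp add: lin_def)
  then have "N \<in> EC l T_ord" using M_card by (simp add: EC_def is_model_T_ord_iff_dlo N_def)
  then obtain f where "elem_embedding f N M"
    using M unfolding superlimit_def universal_def by blast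
  then have f: "ord_emb f N M" by (rule elem_embedding_ord_emb)
  have "isomorphic P N" using isoNP by (rule isomorphic_sym)
  then obtain h' where h': "ord_emb h' P N" by (rule isomorphicE)
  obtain m where m: "m \<in> universe M" using M_dlo by (auto simp: dlo_def)
  have "ord_emb (\<lambda>y. (y, m)) Y P"
    using m lin_irrefl[OF M_lin] by (auto simp: ord_emb_def Psel)
  then show ?thesis using that ord_emb_comp[OF ord_emb_comp[OF _ h'] f] by blast
qed

section \<open>Index orders: the successor of \<open>l\<close> and the regular cardinal
  \<open>k\<close>\<close>

abbreviation r :: "'l set rel" where "r \<equiv> cardSuc l"

lemma r: "Card_order r" "Well_order r" "wo_rel r"
  using cardSuc_Card_order[OF l(1)] unfolding wo_rel_def card_order_on_def by blast+

lemma k_wo: "Well_order k" "wo_rel k"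
  using k(1) unfolding wo_rel_def card_order_on_def by blast+

lemma k_refl: "i \<in> Field k \<Longrightarrow> (i, i) \<in> k"
  using wo_rel.REFL[OF k_wo(2)] by (simp add: refl_on_def)

lemma k_trans: "(i, j) \<in> k \<Longrightarrow> (j, m) \<in> k \<Longrightarrow> (i, m) \<in> k"
  using wo_rel.TRANS[OF k_wo(2)] by (rule transD)

lemma k_antisym: "(i, j) \<in> k \<Longrightarrow> (j, i) \<in> k \<Longrightarrow> i = j"
  using wo_rel.ANTISYM[OF k_wo(2)] by (rule antisymD)

lemma k_total: "i \<in> Field k \<Longrightarrow> j \<in> Field k \<Longrightarrow> (i, j) \<in> k \<or> (j, i) \<in> k"
  using wo_rel.TOTALS[OF k_wo(2)] by blast

lemma k_dom: "(i, j) \<in> k \<Longrightarrow> i \<in> Field k \<and> j \<in> Field k"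
  by (auto simp: Field_def)

lemma k_limit: "i \<in> Field k \<Longrightarrow> \<exists>j\<in>Field k. i \<noteq> j \<and> (i, j) \<in> k"
  using infinite_Card_order_limit[OF k(1)] k(2) by (simp add: cinfinite_def)

lemma k_nonempty: "Field k \<noteq> {}"
  using k(2) by (auto simp: cinfinite_def)

lemma k_wf: "wf (k - Id)"
  using wo_rel.WF[OF k_wo(2)] .

text \<open>As \<open>k\<close> is smaller than \<open>cardSuc l\<close>, some proper initial
  segment of the latter has order type \<open>k\<close>. Its bound \<open>d\<close> is a limit
  because \<open>k\<close> has no last element, and has cofinality \<open>k\<close> because
  \<open>k\<close> is regular.\<close>

lemma limit_index:
  obtains d \<phi> where "d \<in> Field r" "bij_betw \<phi> (Field k) (underS r d)"
    "\<And>a b. a \<in> Field k \<Longrightarrow> b \<in> Field k \<Longrightarrow> (\<phi> a, \<phi> b) \<in> r \<longleftrightarrow> (a, b) \<in> k"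
    "is_limit r d" "has_cf (Restr r (underS r d)) k"
proof -
  have "k <o r" using kl cardSuc_greater[OF l(1)] by (rule ordLess_transitive)
  then obtain d where d: "d \<in> Field r" "k =o Restr r (underS r d)"
    using ordLess_iff_ordIso_Restr[OF r(2) k_wo(1)] by blast
  let ?R = "Restr r (underS r d)"
  have F: "Field ?R = underS r d"
    using wo_rel.underS_ofilter[OF r(3)] by (simp add: Field_Restr_ofilter[OF r(2)])
  obtain \<phi> where "iso k ?R \<phi>" using d(2) unfolding ordIso_def by blast
  then have \<phi>: "bij_betw \<phi> (Field k) (underS r d)"
    "\<And>a b. a \<in> Field k \<Longrightarrow> b \<in> Field k \<Longrightarrow> (a, b) \<in> k \<longleftrightarrow> (\<phi> a, \<phi> b) \<in> ?R"
    unfolding iso_iff2 F by auto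
  have \<phi>m: "\<phi> a \<in> underS r d" if "a \<in> Field k" for a using \<phi>(1) that by (auto simp: bij_betw_def)
  have \<phi>r: "(\<phi> a, \<phi> b) \<in> r \<longleftrightarrow> (a, b) \<in> k" if "a \<in> Field k" "b \<in> Field k" for a b
    using \<phi>(2)[OF that] \<phi>m that by auto
  have \<phi>i: "inj_on \<phi> (Field k)" using \<phi>(1) by (simp add: bij_betw_def)
  have \<phi>s: "\<exists>a\<in>Field k. x = \<phi> a" if "x \<in> underS r d" for x
    using \<phi>(1) that by (auto simp: bij_betw_def)
  have up: "\<exists>y\<in>underS r d. x \<noteq> y \<and> (x, y) \<in> r" if x: "x \<in> underS r d" for x
  proof -
    obtain a where a: "a \<in> Field k" "x = \<phi> a" using \<phi>s[OF x] by blast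
    obtain b where b: "b \<in> Field k" "a \<noteq> b" "(a, b) \<in> k" using k_limit[OF a(1)] by blast
    have "x \<noteq> \<phi> b" using inj_onD[OF \<phi>i _ a(1) b(1)] b(2) a(2) by blast
    moreover have "(x, \<phi> b) \<in> r" using \<phi>r[OF a(1) b(1)] b(3) a(2) by blast
    ultimately show ?thesis using \<phi>m[OF b(1)] by blast
  qed
  have "is_limit r d"
    unfolding is_limit_def
  proof (intro conjI ballI)
    show "underS r d \<noteq> {}" using \<phi>m k_nonempty by blast
    fix x assume x: "x \<in> underS r d"
    then obtain y where y: "y \<in> underS r d" "x \<noteq> y" "(x, y) \<in> r" using up by blast
    then have "y \<in> AboveS r {x}" by (auto simp: AboveS_def Field_def)
    then have "(wo_rel.suc r {x}, y) \<in> r" by (rule wo_rel.suc_least_AboveS[OF r(3)])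
    then show "wo_rel.suc r {x} \<noteq> d"
      using y(1) wo_rel.ANTISYM[OF r(3)] by (auto simp: underS_def antisym_def)
  qed (rule d(1))
  moreover have "has_cf ?R k"
    unfolding has_cf_def
  proof (intro conjI allI impI)
    have "|underS r d| =o k"
      using \<phi>(1) card_of_ordIso card_of_Field_ordIso[OF k(1)] ordIso_symmetric ordIso_transitive
      by metis
    moreover have "cofinal (underS r d) ?R" unfolding cofinal_def F using up by blast
    ultimately show "\<exists>A\<subseteq>Field ?R. cofinal A ?R \<and> |A| =o k" unfolding F by blast
    fix A assume A: "A \<subseteq> Field ?R" "cofinal A ?R"
    \<comment> \<open>Pulling \<open>A\<close> back along \<open>\<phi>\<close> gives a cofinal
      subset of \<open>k\<close>, which has size \<open>k\<close> by regularity.\<close>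
    let ?K = "{a \<in> Field k. \<phi> a \<in> A}"
    have "cofinal ?K k"
      unfolding cofinal_def
    proof
      fix a assume a: "a \<in> Field k"
      then obtain y where y: "y \<in> A" "\<phi> a \<noteq> y" "(\<phi> a, y) \<in> ?R"
        using A(2) \<phi>m unfolding cofinal_def F by blast
      then obtain b where "b \<in> Field k" "y = \<phi> b" using \<phi>s by blast
      then show "\<exists>b\<in>?K. a \<noteq> b \<and> (a, b) \<in> k" using y a \<phi>r by auto
    qed
    then have "|?K| =o k" using reg unfolding regularCard_def by auto
    moreover have "|?K| \<le>o |A|"
      using \<phi>i card_of_ordLeq[of ?K A] by (metis (no_types, lifting) image_subsetI inj_on_subset
          mem_Collect_eq subsetI)
    ultimately show "k \<le>o |A|" by (meson ordIso_ordLeq_trans ordIso_symmetric)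
  qed
  ultimately show thesis using that[OF d(1) \<phi>(1) \<phi>r] by blast
qed

text \<open>
  Replacing the \<open>b\<close>th member by the union of its predecessors makes the chain continuous, and then
  the successor members are the original ones.
\<close>

lemma chain_union_aux:
  fixes Q :: "'l set \<Rightarrow> 'a ostruct"
  assumes d: "d \<in> Field r" "is_limit r d" "has_cf (Restr r (underS r d)) k"
    and iso: "\<And>a. a \<in> underS r d \<Longrightarrow> isomorphic (Q a) M"
    and lin: "\<And>a. a \<in> underS r d \<Longrightarrow> lin (Q a)"
    and mono: "\<And>a b. (a, b) \<in> r \<Longrightarrow> b \<in> underS r d \<Longrightarrow> substr (Q a) (Q b)"
  shows "isomorphic (union_struct (underS r d) Q) M"
proof -
  note rt = transD[OF wo_rel.TRANS[OF r(3)]] and ra = antisymD[OF wo_rel.ANTISYM[OF r(3)]]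
  have rr: "(a, a) \<in> r" if "a \<in> Field r" for a
    using wo_rel.REFL[OF r(3)] that by (simp add: refl_on_def)
  have rtot: "(a, b) \<in> r \<or> (b, a) \<in> r" if "a \<in> Field r" "b \<in> Field r" for a b
    using wo_rel.TOTALS[OF r(3)] that by blast
  define z where "z = wo_rel.minim r (Field r)"
  have ne: "underS r d \<noteq> {}" using d(2) by (simp add: is_limit_def)
  have zmin: "(z, a) \<in> r" if "a \<in> Field r" for a
    using wo_rel.minim_least[OF r(3)] that by (auto simp: z_def)
  have zd: "z \<in> underS r d"
    using ne zmin d(1) ra by (auto simp: underS_def Field_def)
  \<comment> \<open>Inserting the least index \<open>z\<close> changes the union only at
    \<open>b = z\<close>, where it gives \<open>Q z\<close> instead of the empty structure.\<close>
  define MM where "MM b = union_struct (insert z (underS r b)) Q" for b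
  have sub: "insert z (underS r b) \<subseteq> underS r d" if "(b, d) \<in> r" for b
    using zd that rt ra unfolding underS_def by blast
  have fld: "a \<in> Field r" if "a \<in> underS r d" for a
    using that by (auto simp: underS_def Field_def)
  have dir: "\<exists>c\<in>I. substr (Q a) (Q c) \<and> substr (Q b) (Q c)"
    if I: "I \<subseteq> underS r d" and ab: "a \<in> I" "b \<in> I" for I a b
  proof -
    have "a \<in> underS r d" "b \<in> underS r d" using I ab by auto
    then consider "(a, b) \<in> r" | "(b, a) \<in> r" using rtot fld by blast
    then show ?thesis
      by cases (use mono ab ord_emb_refl I in blast)+
  qed
  have dloQ: "dlo (Q a)" if "a \<in> underS r d" for a
    using dlo_isomorphic[OF M_dlo _ iso[OF that]] lin[OF that] by (simp add: lin_def)
  have dloMM: "dlo (MM b)" if "(b, d) \<in> r" for b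
    unfolding MM_def using dir[OF sub[OF that]] dloQ sub[OF that]
    by (intro dlo_union) blast+
  have subMM: "substr (MM a) (MM b)" if ab: "(a, b) \<in> r" "(b, d) \<in> r" for a b
  proof (rule ord_embI)
    have ad: "(a, d) \<in> r" using ab rt by blast
    show "lin (MM a)" "lin (MM b)" using dloMM ad ab(2) dlo_lin by blast+
    have "underS r a \<subseteq> underS r b" using ab(1) rt ra unfolding underS_def by blast
    then show "x \<in> universe (MM b)" if "x \<in> universe (MM a)" for x
      using that by (auto simp: MM_def)
    show "(x, y) \<in> lt (MM b)" if "(x, y) \<in> lt (MM a)" for x y
      using that \<open>underS r a \<subseteq> underS r b\<close> by (auto simp: MM_def)
  qed
  have suc: "MM (wo_rel.suc r {a}) = Q a" and sucd: "(wo_rel.suc r {a}, d) \<in> r"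
    and asuc: "a \<in> underS r (wo_rel.suc r {a})"
    if a: "a \<in> underS r d" for a
  proof -
    have AS: "d \<in> AboveS r {a}" using a d(1) by (auto simp: AboveS_def underS_def)
    then show sd: "(wo_rel.suc r {a}, d) \<in> r" by (rule wo_rel.suc_least_AboveS[OF r(3)])
    have "wo_rel.suc r {a} \<noteq> a \<and> (a, wo_rel.suc r {a}) \<in> r"
      using AS fld[OF a] by (intro wo_rel.suc_greater[OF r(3)]) auto
    then show as: "a \<in> underS r (wo_rel.suc r {a})" unfolding underS_def by blast
    \<comment> \<open>The predecessors of the successor of \<open>a\<close> are the indices up to
      \<open>a\<close>, so the union over them has greatest member \<open>Q a\<close>.\<close>
    have le: "(x, a) \<in> r" if x: "x \<in> insert z (underS r (wo_rel.suc r {a}))" for x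
    proof (cases "x = z")
      case False
      then have x: "x \<noteq> wo_rel.suc r {a}" "(x, wo_rel.suc r {a}) \<in> r"
        using x unfolding underS_def by blast+
      show ?thesis
      proof (rule ccontr)
        assume n: "(x, a) \<notin> r"
        have xF: "x \<in> Field r" using x by (auto simp: Field_def)
        then have "(a, x) \<in> r" "a \<noteq> x" using n rtot fld[OF a] rr by blast+
        then have "x \<in> AboveS r {a}" using xF by (auto simp: AboveS_def)
        then have "(wo_rel.suc r {a}, x) \<in> r" by (rule wo_rel.suc_least_AboveS[OF r(3)])
        then show False using x ra by blast
      qed
    qed (use zmin fld[OF a] in auto)
    show "MM (wo_rel.suc r {a}) = Q a"
      unfolding MM_def
      by (rule union_struct_max) (use as lin sub[OF sd] mono[OF le a] in auto)
  qed
  have inc: "elem_inc_cont r d MM"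
    unfolding elem_inc_cont_def
  proof (intro conjI allI impI)
    fix a b assume "(a, b) \<in> r \<and> (b, d) \<in> r"
    then show "elem_substruct (MM a) (MM b)"
      using elem_substruct_dlo[OF dloMM dloMM subMM] rt by blast
  next
    fix b assume b: "(b, d) \<in> r \<and> is_limit r b"
    then have bl: "\<And>a. a \<in> underS r b \<Longrightarrow> wo_rel.suc r {a} \<noteq> b" and bne: "underS r b \<noteq> {}"
      by (auto simp: is_limit_def)
    have bd: "underS r b \<subseteq> underS r d" using sub b by blast
    have zb: "z \<in> underS r b" using bne zmin ra by (auto simp: underS_def Field_def)
    \<comment> \<open>Below a limit \<open>b\<close>, successors of smaller indices are again below
      \<open>b\<close>. So each \<open>Q a\<close> occurs among the earlier \<open>MM\<close>, at a
      successor, which gives continuity at \<open>b\<close>.\<close>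
    have sb: "wo_rel.suc r {a} \<in> underS r b" if a: "a \<in> underS r b" for a
    proof -
      have "b \<in> AboveS r {a}" using a by (auto simp: AboveS_def underS_def Field_def)
      then show ?thesis using bl[OF a] wo_rel.suc_least_AboveS[OF r(3)] by (auto simp: underS_def)
    qed
    have le: "insert z (underS r a) \<subseteq> underS r b" if "a \<in> underS r b" for a
      using zb that rt ra unfolding underS_def by blast
    have ge: "Q a = MM (wo_rel.suc r {a})" if "a \<in> underS r b" for a
      using suc bd that by (metis subsetD)
    have ins: "insert z (underS r b) = underS r b" using zb by auto
    show "universe (MM b) = (\<Union>a\<in>underS r b. universe (MM a))"
    proof
      show "universe (MM b) \<subseteq> (\<Union>a\<in>underS r b. universe (MM a))"
        using ge sb by (subst MM_def) (simp add: ins, blast)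
      show "(\<Union>a\<in>underS r b. universe (MM a)) \<subseteq> universe (MM b)"
        using le unfolding MM_def by (simp add: ins) blast
    qed
    show "lt (MM b) = (\<Union>a\<in>underS r b. lt (MM a))"
    proof
      show "lt (MM b) \<subseteq> (\<Union>a\<in>underS r b. lt (MM a))"
        using ge sb by (subst MM_def) (simp add: ins, blast)
      show "(\<Union>a\<in>underS r b. lt (MM a)) \<subseteq> lt (MM b)"
        using le unfolding MM_def by (simp add: ins) blast
    qed
  qed
  have "isomorphic (MM d) M"
    using M d inc suc iso unfolding superlimit_def by metis
  moreover have "insert z (underS r d) = underS r d" using zd by auto
  ultimately show ?thesis by (simp add: MM_def)
qed

text \<open>Frees \<open>chain_union_aux\<close> from the type \<open>'a\<close> and from indices in
  \<open>cardSuc l\<close>: the union has at most \<open>l\<close> points and is injected into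
  \<open>universe M\<close>, and \<open>limit_index\<close> identifies \<open>k\<close> with an
  initial segment of \<open>cardSuc l\<close>.\<close>

lemma chain_union:
  fixes N :: "'k \<Rightarrow> 'b ostruct"
  assumes iso: "\<And>i. i \<in> Field k \<Longrightarrow> isomorphic (N i) M"
    and lin: "\<And>i. i \<in> Field k \<Longrightarrow> lin (N i)"
    and mono: "\<And>i j. (i, j) \<in> k \<Longrightarrow> substr (N i) (N j)"
  shows "isomorphic (union_struct (Field k) N) M"
proof -
  let ?U = "union_struct (Field k) N"
  have dir: "\<exists>m\<in>Field k. substr (N i) (N m) \<and> substr (N j) (N m)"
    if "i \<in> Field k" "j \<in> Field k" for i j
    using k_total[OF that] mono ord_emb_refl that by blast
  have linU: "lin ?U" by (rule lin_union[OF dir lin])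
  have subU: "substr (N i) ?U" if "i \<in> Field k" for i by (rule substr_union[OF dir lin that])
  have "|universe ?U| \<le>o |universe M|"
  proof -
    have "|Field k| \<le>o |universe M|"
      by (rule le_M) (use kl card_of_Field_ordIso[OF k(1)] ordIso_ordLess_trans ordLess_imp_ordLeq in blast)
    moreover have "\<forall>i\<in>Field k. |universe (N i)| \<le>o |universe M|"
      using iso isomorphicE card_of_ordIso ordIso_imp_ordLeq by metis
    ultimately show ?thesis
      using card_of_UNION_ordLeq_infinite[OF infinite_M] by simp
  qed
  then obtain \<iota> where \<iota>: "inj_on \<iota> (universe ?U)" "\<iota> ` universe ?U \<subseteq> universe M"
    using card_of_ordLeq by metis
  \<comment> \<open>One injection of the whole union serves all members, so that the copies still
    form a chain.\<close>
  define img where "img = image_struct \<iota>"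
  have img_iso: "isomorphic (img X) X" and img_lin: "lin (img X)"
    if X: "lin X" "universe X \<subseteq> universe ?U" for X
    using isomorphic_image_struct[OF X(1) inj_on_subset[OF \<iota>(1) X(2)]]
      lin_image_struct[OF X(1) inj_on_subset[OF \<iota>(1) X(2)]] by (simp_all add: img_def)
  have NU: "universe (N i) \<subseteq> universe ?U" if "i \<in> Field k" for i using that by auto
  obtain d \<phi> where d: "d \<in> Field r" "is_limit r d" "has_cf (Restr r (underS r d)) k"
    and \<phi>: "bij_betw \<phi> (Field k) (underS r d)"
    "\<And>a b. a \<in> Field k \<Longrightarrow> b \<in> Field k \<Longrightarrow> (\<phi> a, \<phi> b) \<in> r \<longleftrightarrow> (a, b) \<in> k"
    using limit_index by metis
  define \<psi> where "\<psi> = inv_into (Field k) \<phi>"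
  have \<psi>: "\<psi> a \<in> Field k" "\<phi> (\<psi> a) = a" if "a \<in> underS r d" for a
    using that \<phi>(1) by (auto simp: \<psi>_def bij_betw_def inv_into_into f_inv_into_f)
  define Q where "Q a = img (N (\<psi> a))" for a
  have "isomorphic (union_struct (underS r d) Q) M"
  proof (rule chain_union_aux[OF d])
    fix a assume a: "a \<in> underS r d"
    note f = \<psi>(1)[OF a]
    show "isomorphic (Q a) M"
      unfolding Q_def by (rule isomorphic_trans[OF img_iso[OF lin[OF f] NU[OF f]] iso[OF f]])
    show "lin (Q a)" unfolding Q_def by (rule img_lin[OF lin[OF f] NU[OF f]])
  next
    fix a b assume ab: "(a, b) \<in> r" "b \<in> underS r d"
    then have a: "a \<in> underS r d"
      using wo_rel.underS_ofilter[OF r(3), of d] unfolding wo_rel.ofilter_def[OF r(3)] under_def by blast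
    have "(\<psi> a, \<psi> b) \<in> k" using \<phi>(2)[of "\<psi> a" "\<psi> b"] \<psi>[OF a] \<psi>[OF ab(2)] ab(1) by simp
    then have s: "substr (N (\<psi> a)) (N (\<psi> b))" by (rule mono)
    note f = \<psi>(1)[OF a] and g = \<psi>(1)[OF ab(2)]
    show "substr (Q a) (Q b)"
      unfolding Q_def
    proof (rule ord_embI[OF img_lin[OF lin[OF f] NU[OF f]] img_lin[OF lin[OF g] NU[OF g]]])
      show "x \<in> universe (img (N (\<psi> b)))" if "x \<in> universe (img (N (\<psi> a)))" for x
        using that ord_emb_mem[OF s] by (auto simp: img_def image_struct_def)
      show "(x, y) \<in> lt (img (N (\<psi> b)))" if "(x, y) \<in> lt (img (N (\<psi> a)))" for x y
        using that ord_emb_lessD[OF s lin[OF f]] by (auto simp: img_def image_struct_def)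
    qed
  qed
  moreover have "union_struct (underS r d) Q = img ?U"
  proof -
    have un: "(\<Union>a\<in>underS r d. F (\<psi> a)) = (\<Union>i\<in>Field k. F i)" for F :: "'k \<Rightarrow> 'z set"
    proof -
      have "\<psi> ` underS r d = Field k"
        using bij_betw_inv_into[OF \<phi>(1)] by (simp add: \<psi>_def bij_betw_def)
      then show ?thesis by (metis image_image)
    qed
    show ?thesis
      using un[of "\<lambda>i. \<iota> ` universe (N i)"] un[of "\<lambda>i. map_prod \<iota> \<iota> ` lt (N i)"]
      by (simp add: union_struct_def Q_def img_def image_struct_def image_UN)
  qed
  ultimately have "isomorphic (img ?U) M" by simp
  then show ?thesis
    using img_iso[OF linU] isomorphic_sym isomorphic_trans by blast
qed

end

section \<open>Points that a set does not approach from below\<close>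

definition seg :: "'a ostruct \<Rightarrow> 'a \<Rightarrow> 'a \<Rightarrow> 'a set" where
  "seg N q p = {x. (x = q \<or> (q, x) \<in> lt N) \<and> (x, p) \<in> lt N}"

text \<open>The interval is half-open and contains \<open>q\<close>, so \<open>q\<close> itself lies
  outside \<open>A\<close>; \<open>embed_cofinal\<close> relies on this.\<close>

definition left_isolated :: "'a ostruct \<Rightarrow> 'a set \<Rightarrow> 'a \<Rightarrow> bool" where
  "left_isolated N A p \<longleftrightarrow> (\<exists>q. (q, p) \<in> lt N \<and> seg N q p \<inter> A = {})"

text \<open>Points of \<open>N'\<close> outside the image of \<open>N\<close> may enter the
  interval, but they are not in the image of \<open>A\<close> and do no harm.\<close>

lemma left_isolated_emb:
  assumes f: "ord_emb f N N'" "lin N" "lin N'" and A: "A \<subseteq> universe N" and p: "p \<in> universe N"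
    and iso: "left_isolated N A p"
  shows "left_isolated N' (f ` A) (f p)"
proof -
  obtain q where q: "(q, p) \<in> lt N" "seg N q p \<inter> A = {}"
    using iso unfolding left_isolated_def by blast
  have qN: "q \<in> universe N" using lin_dom[OF f(2) q(1)] by simp
  have "f a \<notin> seg N' (f q) (f p)" if a: "a \<in> A" for a
  proof
    assume "f a \<in> seg N' (f q) (f p)"
    then have "a = q \<or> (q, a) \<in> lt N" "(a, p) \<in> lt N"
      using ord_emb_less[OF f(1)] inj_onD[OF ord_emb_inj[OF f]] a A p qN
      unfolding seg_def by blast+
    then show False using a q(2) unfolding seg_def by blast
  qed
  moreover have "(f q, f p) \<in> lt N'" using ord_emb_lessD[OF f(1,2) q(1)] .
  ultimately show ?thesis unfolding left_isolated_def by blast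
qed

lemma left_isolated_mono: "left_isolated N A p \<Longrightarrow> B \<subseteq> A \<Longrightarrow> left_isolated N B p"
  unfolding left_isolated_def by blast

section \<open>Amalgamating two linear orders over their intersection\<close>

text \<open>
  Elements of \<open>E\<close> are placed as high as possible: \<open>d \<in> E - W\<close> is below \<open>x \<in> W\<close> only if an element of
  the intersection forces this.
\<close>

lemma amalgam:
  fixes W E :: "'b ostruct"
  assumes W: "lin W" and E: "lin E"
    and agree: "\<And>x y. x \<in> universe W \<inter> universe E \<Longrightarrow> y \<in> universe W \<inter> universe E \<Longrightarrow>
      (x, y) \<in> lt W \<longleftrightarrow> (x, y) \<in> lt E"
  obtains Z where "lin Z" "universe Z = universe W \<union> universe E" "substr W Z" "substr E Z"
    "\<And>d x. d \<in> universe E - universe W \<Longrightarrow> x \<in> universe W \<Longrightarrow> (d, x) \<in> lt Z \<Longrightarrow>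
      \<exists>c\<in>universe W \<inter> universe E. (d, c) \<in> lt E \<and> (c = x \<or> (c, x) \<in> lt W)"
proof -
  let ?C = "universe W \<inter> universe E" and ?D = "universe E - universe W"
  define bel where "bel d x \<longleftrightarrow> (\<exists>c\<in>?C. (d, c) \<in> lt E \<and> (c = x \<or> (c, x) \<in> lt W))" for d x
  define Z where "Z = \<lparr>universe = universe W \<union> universe E,
    lt = lt W \<union> (lt E \<inter> ?D \<times> ?D) \<union> {(d, x). d \<in> ?D \<and> x \<in> universe W \<and> bel d x} \<union>
      {(x, d). d \<in> ?D \<and> x \<in> universe W \<and> \<not> bel d x}\<rparr>"
  note Wt = lin_trans[OF W] and Et = lin_trans[OF E]
  have ltWW: "(x, y) \<in> lt Z \<longleftrightarrow> (x, y) \<in> lt W" if "x \<in> universe W" "y \<in> universe W" for x y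
    using that by (auto simp: Z_def)
  have ltDD: "(x, y) \<in> lt Z \<longleftrightarrow> (x, y) \<in> lt E" if "x \<in> ?D" "y \<in> ?D" for x y
    using that lin_dom[OF W] by (auto simp: Z_def)
  have ltDW: "(d, x) \<in> lt Z \<longleftrightarrow> bel d x" and ltWD: "(x, d) \<in> lt Z \<longleftrightarrow> \<not> bel d x"
    if "d \<in> ?D" "x \<in> universe W" for d x
    using that lin_dom[OF W] by (auto simp: Z_def)
  have dom: "x \<in> universe W \<union> ?D \<and> y \<in> universe W \<union> ?D" if "(x, y) \<in> lt Z" for x y
    using that lin_dom[OF W] lin_dom[OF E] by (auto simp: Z_def)
  \<comment> \<open>\<open>bel\<close> is monotone in both arguments: upwards in \<open>W\<close>,
    downwards in \<open>E\<close>. With the totality of the two orders this settles the mixed cases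
    of transitivity.\<close>
  have belW: "bel d y" if "bel d x" "(x, y) \<in> lt W" for d x y
    using that Wt unfolding bel_def by blast
  have belE: "bel d x" if "bel d' x" "(d, d') \<in> lt E" for d d' x
    using that Et unfolding bel_def by blast
  have linZ: "lin Z"
  proof (rule linI)
    fix x y assume "(x, y) \<in> lt Z"
    then show "x \<in> universe Z \<and> y \<in> universe Z" using dom by (auto simp: Z_def)
  next
    fix x show "(x, x) \<notin> lt Z"
      using lin_irrefl[OF W] lin_irrefl[OF E] by (auto simp: Z_def)
  next
    fix x y assume xy: "x \<in> universe Z" "y \<in> universe Z" "x \<noteq> y"
    consider "x \<in> universe W" "y \<in> universe W" | "x \<in> universe W" "y \<in> ?D"
      | "x \<in> ?D" "y \<in> universe W" | "x \<in> ?D" "y \<in> ?D"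
      using xy by (auto simp: Z_def)
    then show "(x, y) \<in> lt Z \<or> (y, x) \<in> lt Z"
    proof cases
      case 1 then show ?thesis using lin_total[OF W] xy(3) ltWW by blast
    next
      case 2 then show ?thesis using ltDW ltWD by blast
    next
      case 3 then show ?thesis using ltDW ltWD by blast
    next
      case 4 then show ?thesis using lin_total[OF E] xy(3) ltDD by blast
    qed
  next
    fix x y z assume xy: "(x, y) \<in> lt Z" and yz: "(y, z) \<in> lt Z"
    have x: "x \<in> universe W \<or> x \<in> ?D" and y: "y \<in> universe W \<or> y \<in> ?D"
      and z: "z \<in> universe W \<or> z \<in> ?D"
      using dom[OF xy] dom[OF yz] by blast+
    show "(x, z) \<in> lt Z"
    proof (cases "y \<in> universe W")
      case yW: True
      show ?thesis
      proof (cases "x \<in> universe W")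
        case xW: True
        then have xy': "(x, y) \<in> lt W" using xy ltWW yW by blast
        show ?thesis
        proof (cases "z \<in> universe W")
          case True
          then show ?thesis using xy' yz ltWW xW yW Wt by metis
        next
          case False
          then show ?thesis using z xy' yz ltWD xW yW belW by metis
        qed
      next
        case False
        then have xD: "x \<in> ?D" using x by blast
        then have b: "bel x y" using xy ltDW yW by blast
        show ?thesis
        proof (cases "z \<in> universe W")
          case True
          then show ?thesis using b yz ltWW ltDW xD yW belW by metis
        next
          case False
          then have zD: "z \<in> ?D" using z by blast
          have nb: "\<not> bel z y" using ltWD[OF zD yW] yz by blast
          obtain c where c: "c \<in> ?C" "(x, c) \<in> lt E" "c = y \<or> (c, y) \<in> lt W"
            using b unfolding bel_def by blast
          have "x \<noteq> z" using b nb by blast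
          moreover have "(z, x) \<notin> lt E" using b nb belE by blast
          ultimately have "(x, z) \<in> lt E" using lin_total[OF E, of x z] xD zD by blast
          then show ?thesis using ltDD xD zD by blast
        qed
      qed
    next
      case False
      then have yD: "y \<in> ?D" using y by blast
      show ?thesis
      proof (cases "x \<in> universe W")
        case xW: True
        then have nb: "\<not> bel y x" using ltWD[OF yD xW] xy by blast
        show ?thesis
        proof (cases "z \<in> universe W")
          case zW: True
          then have b: "bel y z" using ltDW[OF yD zW] yz by blast
          then have "x \<noteq> z" "(z, x) \<notin> lt W" using nb belW by blast+
          then have "(x, z) \<in> lt W" using lin_total[OF W xW zW] by blast
          then show ?thesis using ltWW xW zW by blast
        next
          case False
          then have zD: "z \<in> ?D" using z by blast
          then have "(y, z) \<in> lt E" using yz ltDD yD by blast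
          then have "\<not> bel z x" using nb belE by blast
          then show ?thesis using ltWD[OF zD xW] by blast
        qed
      next
        case False
        then have xD: "x \<in> ?D" using x by blast
        then have xy': "(x, y) \<in> lt E" using xy ltDD yD by blast
        show ?thesis
        proof (cases "z \<in> universe W")
          case True
          then show ?thesis using ltDW[OF xD True] ltDW[OF yD True] yz xy' belE by blast
        next
          case False
          then have zD: "z \<in> ?D" using z by blast
          then show ?thesis using yz ltDD xD yD xy' Et by blast
        qed
      qed
    qed
  qed
  have subW: "substr W Z" using ltWW by (auto simp: ord_emb_def Z_def)
  have subE: "substr E Z"
  proof (rule ord_embI[OF E linZ])
    show "x \<in> universe Z" if "x \<in> universe E" for x using that by (simp add: Z_def)
    fix x y assume xy: "(x, y) \<in> lt E"
    have xE: "x \<in> universe E" and yE: "y \<in> universe E" using lin_dom[OF E xy] by auto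
    consider "x \<in> ?C" "y \<in> ?C" | "x \<in> ?C" "y \<in> ?D" | "x \<in> ?D" "y \<in> ?C" | "x \<in> ?D" "y \<in> ?D"
      using xE yE by blast
    then show "(x, y) \<in> lt Z"
    proof cases
      case 1 then show ?thesis using agree xy ltWW by blast
    next
      case 2
      \<comment> \<open>A common point that forces \<open>y\<close> below \<open>x\<close> would, by
        \<open>agree\<close>, force it within \<open>E\<close> already, against
        \<open>xy\<close>.\<close>
      have "\<not> bel y x"
      proof
        assume "bel y x"
        then obtain c where c: "c \<in> ?C" "(y, c) \<in> lt E" "c = x \<or> (c, x) \<in> lt W"
          unfolding bel_def by blast
        then have "c = x \<or> (c, x) \<in> lt E" using agree 2 by blast
        then have "(y, x) \<in> lt E" using c(2) Et by blast
        then show False using lin_asym[OF E xy] by blast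
      qed
      then show ?thesis using ltWD 2 by blast
    next
      case 3 then show ?thesis using ltDW xy unfolding bel_def by blast
    next
      case 4 then show ?thesis using ltDD xy by blast
    qed
  qed
  have "universe Z = universe W \<union> universe E" by (simp add: Z_def)
  moreover have "\<exists>c\<in>?C. (d, c) \<in> lt E \<and> (c = x \<or> (c, x) \<in> lt W)"
    if "d \<in> ?D" "x \<in> universe W" "(d, x) \<in> lt Z" for d x
    using ltDW that unfolding bel_def by blast
  ultimately show thesis using that linZ subW subE by blast
qed

section \<open>Recursive construction of chains\<close>

context superlimit_order
begin

text \<open>The base is indexed by \<open>None\<close>, so that it forms one directed family with
  the members before \<open>i\<close>. At the least \<open>i\<close> the stage is \<open>B\<close>
  itself.\<close>

definition stage :: "'b ostruct \<Rightarrow> ('k \<Rightarrow> 'b ostruct) \<Rightarrow> 'k \<Rightarrow> 'b ostruct" where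
  "stage B N i = union_struct (insert None (Some ` underS k i)) (case_option B N)"

lemma universe_stage: "universe (stage B N i) = universe B \<union> (\<Union>j\<in>underS k i. universe (N j))"
  and lt_stage: "lt (stage B N i) = lt B \<union> (\<Union>j\<in>underS k i. lt (N j))"
  by (auto simp: stage_def)

text \<open>\<open>Q\<close> receives the union of everything before \<open>i\<close> together with
  the new member, so that conditions can compare old and new points.\<close>

definition good_stage ::
    "'b ostruct \<Rightarrow> ('k \<Rightarrow> 'b ostruct \<Rightarrow> 'b ostruct \<Rightarrow> bool) \<Rightarrow> ('k \<Rightarrow> 'b ostruct) \<Rightarrow> 'k \<Rightarrow> 'b ostruct \<Rightarrow> bool"
  where "good_stage B Q N i X \<longleftrightarrow> lin X \<and> isomorphic X M \<and> substr (stage B N i) X \<and> Q i (stage B N i) X"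

lemma card_k_le: "|Field k| \<le>o l"
  using kl card_of_Field_ordIso[OF k(1)] ordIso_ordLess_trans ordLess_imp_ordLeq by blast

lemma Un_le: "|A| \<le>o l \<Longrightarrow> |B| \<le>o l \<Longrightarrow> |A \<union> B| \<le>o l"
  using card_of_Un_ordLeq_infinite_Field l unfolding cinfinite_def by blast

lemma Times_le: "|A| \<le>o l \<Longrightarrow> |B| \<le>o l \<Longrightarrow> |A \<times> B| \<le>o l"
  using card_of_Times_ordLeq_infinite_Field l unfolding cinfinite_def by blast

lemma UN_le: "|I| \<le>o l \<Longrightarrow> \<forall>i\<in>I. |A i| \<le>o l \<Longrightarrow> |\<Union>i\<in>I. A i| \<le>o l"
  using card_of_UNION_ordLeq_infinite_Field l unfolding cinfinite_def by blast

lemma finite_le: "finite A \<Longrightarrow> |A| \<le>o l"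
  using finite_ordLess_infinite[OF card_of_Well_order, of l A] l ordLess_imp_ordLeq
  unfolding cinfinite_def Field_card_of card_order_on_def by blast

lemma image_le: "|A| \<le>o l \<Longrightarrow> |f ` A| \<le>o l"
  using card_of_image ordLeq_transitive by blast

lemma subset_le: "A \<subseteq> B \<Longrightarrow> |B| \<le>o l \<Longrightarrow> |A| \<le>o l"
  using card_of_mono1 ordLeq_transitive by blast

lemma isomorphic_card: "isomorphic N M \<Longrightarrow> |universe N| \<le>o l"
  by (elim isomorphicE) (use card_of_ordIso M_card ordIso_transitive ordIso_imp_ordLeq in blast)

text \<open>Recursion along \<open>k\<close>. Once every member contains its stage as a suborder,
  monotonicity and directedness are automatic, and \<open>chain_union\<close> identifies the union;
  each use supplies only the extension step.\<close>

lemma chain_exists: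
  fixes B :: "'b ostruct" and Q :: "'k \<Rightarrow> 'b ostruct \<Rightarrow> 'b ostruct \<Rightarrow> bool"
  assumes B: "lin B" "|universe B| \<le>o l"
    and step: "\<And>i N. i \<in> Field k \<Longrightarrow> lin (stage B N i) \<Longrightarrow> |universe (stage B N i)| \<le>o l \<Longrightarrow>
      (\<And>j. j \<in> underS k i \<Longrightarrow> good_stage B Q N j (N j)) \<Longrightarrow>
      (\<And>j. j \<in> underS k i \<Longrightarrow> substr (N j) (stage B N i)) \<Longrightarrow> substr B (stage B N i) \<Longrightarrow> \<exists>X. good_stage B Q N i X"
  obtains N where "\<And>i. i \<in> Field k \<Longrightarrow> good_stage B Q N i (N i)"
    "\<And>i. i \<in> Field k \<Longrightarrow> lin (N i)"
    "\<And>i. i \<in> Field k \<Longrightarrow> substr B (N i)"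
    "\<And>i j. (i, j) \<in> k \<Longrightarrow> substr (N i) (N j)"
    "\<And>i. i \<in> Field k \<Longrightarrow> substr (N i) (union_struct (Field k) N)"
    "lin (union_struct (Field k) N)"
    "isomorphic (union_struct (Field k) N) M"
proof -
  have mono: "substr (N i) (N j)"
    if ij: "(i, j) \<in> k" and g: "good_stage B Q N i (N i)" "good_stage B Q N j (N j)" for N i j
  proof (cases "i = j")
    case False
    then have i: "i \<in> underS k j" using ij by (simp add: underS_def)
    have s: "substr (stage B N j) (N j)" and l: "lin (N i)" "lin (N j)"
      using g by (auto simp: good_stage_def)
    show ?thesis
    proof (rule ord_embI[OF l])
      show m: "x \<in> universe (N j)" if "x \<in> universe (N i)" for x
        using ord_emb_mem[OF s] that i by (auto simp: universe_stage)
      fix x y assume xy: "(x, y) \<in> lt (N i)"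
      have "x \<in> universe (stage B N j)" "y \<in> universe (stage B N j)"
        using lin_dom[OF l(1) xy] i by (auto simp: universe_stage)
      then show "(x, y) \<in> lt (N j)" using ord_emb_less[OF s] xy i by (auto simp: lt_stage)
    qed
  qed (simp add: ord_emb_refl)
  have base: "substr B (N j)" if g: "good_stage B Q N j (N j)" for N j
  proof -
    have s: "substr (stage B N j) (N j)" and l: "lin (N j)"
      using g by (auto simp: good_stage_def)
    show ?thesis
    proof (rule ord_embI[OF B(1) l])
      show m: "x \<in> universe (N j)" if "x \<in> universe B" for x
        using ord_emb_mem[OF s] that by (auto simp: universe_stage)
      fix x y assume xy: "(x, y) \<in> lt B"
      have "x \<in> universe (stage B N j)" "y \<in> universe (stage B N j)"
        using lin_dom[OF B(1) xy] by (auto simp: universe_stage)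
      then show "(x, y) \<in> lt (N j)" using ord_emb_less[OF s] xy by (auto simp: lt_stage)
    qed
  qed
  have stage_props: "lin (stage B N i) \<and> |universe (stage B N i)| \<le>o l \<and>
      substr B (stage B N i) \<and> (\<forall>j\<in>underS k i. substr (N j) (stage B N i))"
    if i: "i \<in> Field k" and g: "\<And>j. j \<in> underS k i \<Longrightarrow> good_stage B Q N j (N j)" for N i
  proof (intro conjI ballI)
    let ?I = "insert None (Some ` underS k i)" and ?N = "case_option B N"
    have uF: "j \<in> Field k" if "j \<in> underS k i" for j using that by (auto simp: underS_def Field_def)
    have dir: "\<exists>c\<in>?I. substr (?N a) (?N c) \<and> substr (?N b) (?N c)"
      if ab: "a \<in> ?I" "b \<in> ?I" for a b
    proof (cases a; cases b)
      fix a' b' assume *: "a = Some a'" "b = Some b'"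
      then have a': "a' \<in> underS k i" and b': "b' \<in> underS k i" using ab by auto
      consider "(a', b') \<in> k" | "(b', a') \<in> k" using k_total[OF uF[OF a'] uF[OF b']] by blast
      then show ?thesis
      proof cases
        case 1 then show ?thesis using mono[OF 1 g[OF a'] g[OF b']] * ab ord_emb_refl by force
      next
        case 2 then show ?thesis using mono[OF 2 g[OF b'] g[OF a']] * ab ord_emb_refl by force
      qed
    next
      fix a' assume "a = Some a'" "b = None"
      then show ?thesis using ab base[OF g, of a'] ord_emb_refl by force
    next
      fix b' assume "a = None" "b = Some b'"
      then show ?thesis using ab base[OF g, of b'] ord_emb_refl by force
    next
      assume "a = None" "b = None"
      then show ?thesis using ord_emb_refl by force
    qed
    have lin: "lin (?N a)" if "a \<in> ?I" for a
      using that B(1) g by (auto simp: good_stage_def)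
    show "lin (stage B N i)" unfolding stage_def by (rule lin_union[OF dir lin])
    show "substr B (stage B N i)"
      using substr_union[OF dir lin, of None] unfolding stage_def by auto
    show "substr (N j) (stage B N i)" if "j \<in> underS k i" for j
      using substr_union[OF dir lin, of "Some j"] that unfolding stage_def by auto
    have "|underS k i| \<le>o l"
      using card_k_le card_of_mono1[of "underS k i" "Field k"] uF ordLeq_transitive by blast
    moreover have "\<forall>j\<in>underS k i. |universe (N j)| \<le>o l"
      using g isomorphic_card unfolding good_stage_def by blast
    ultimately show "|universe (stage B N i)| \<le>o l"
      unfolding universe_stage by (intro Un_le UN_le B)
  qed
  \<comment> \<open>The condition on a member depends on the others only through its stage, hence
    only on earlier members, as dependent choice along \<open>k\<close> requires.\<close>
  have "\<exists>N. \<forall>i. i \<in> Field k \<longrightarrow> good_stage B Q N i (N i)"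
  proof (rule dependent_wf_choice[OF k_wf])
    fix N N' :: "'k \<Rightarrow> 'b ostruct" and i X
    assume eq: "\<And>z. (z, i) \<in> k - Id \<Longrightarrow> N z = N' z"
    have "stage B N i = stage B N' i"
      unfolding stage_def by (rule union_struct_cong) (use eq in \<open>auto simp: underS_def\<close>)
    then show "(i \<in> Field k \<longrightarrow> good_stage B Q N i X) = (i \<in> Field k \<longrightarrow> good_stage B Q N' i X)"
      by (simp add: good_stage_def)
  next
    fix i and N :: "'k \<Rightarrow> 'b ostruct"
    assume IH: "\<And>j. (j, i) \<in> k - Id \<Longrightarrow> j \<in> Field k \<longrightarrow> good_stage B Q N j (N j)"
    show "\<exists>X. i \<in> Field k \<longrightarrow> good_stage B Q N i X"
    proof (cases "i \<in> Field k")
      case True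
      have g: "good_stage B Q N j (N j)" if "j \<in> underS k i" for j
        using IH[of j] that k_dom by (auto simp: underS_def)
      show ?thesis using step[OF True _ _ g] stage_props[OF True g] by blast
    qed simp
  qed
  then obtain N where N: "\<And>i. i \<in> Field k \<Longrightarrow> good_stage B Q N i (N i)" by blast
  have mono': "substr (N i) (N j)" if "(i, j) \<in> k" for i j
    using mono[OF that] N k_dom[OF that] by blast
  have dir: "\<exists>m\<in>Field k. substr (N i) (N m) \<and> substr (N j) (N m)"
    if "i \<in> Field k" "j \<in> Field k" for i j
    using k_total[OF that] mono' ord_emb_refl that by blast
  have lin: "lin (N i)" if "i \<in> Field k" for i using N[OF that] by (simp add: good_stage_def)
  show thesis
  proof (rule that[of N, OF N lin _ mono'])
    show "isomorphic (union_struct (Field k) N) M"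
      by (rule chain_union[OF _ lin mono']) (use N in \<open>auto simp: good_stage_def\<close>)
    show "lin (union_struct (Field k) N)" by (rule lin_union[OF dir lin])
    show "substr (N i) (union_struct (Field k) N)" if "i \<in> Field k" for i
      by (rule substr_union[OF dir lin that])
    show "substr B (N i)" if "i \<in> Field k" for i using base N[OF that] .
  qed
qed


section \<open>Splitting the model into sets that approach no point from below\<close>

definition empty_struct :: "'b ostruct" where
  "empty_struct = \<lparr>universe = {}, lt = {}\<rparr>"

lemma empty_struct: "lin empty_struct" "universe empty_struct = {}" "lt empty_struct = {}"
  "|universe (empty_struct :: 'b ostruct)| \<le>o l"
  by (auto simp: empty_struct_def lin_def irrefl_def trans_def total_on_def intro: finite_le)

lemma under_eq: "i \<in> Field k \<Longrightarrow> under k i = insert i (underS k i)"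
  using k_refl by (auto simp: under_def underS_def)

text \<open>Each tag \<open>i\<close> supplies \<open>l\<close> fresh names, enough for a whole copy
  of \<open>M\<close> in \<open>transport\<close>.\<close>

lemma fresh_card: "|universe M| \<le>o |f ` ({i} \<times> Field l)|" if "inj f"
proof -
  have "|Field l| =o |f ` ({i} \<times> Field l)|"
    using that card_of_ordIsoI[of "\<lambda>x. f (i, x)" "Field l" "f ` ({i} \<times> Field l)"]
    by (force simp: bij_betw_def inj_on_def)
  then show ?thesis
    using M_card card_of_Field_ordIso[OF l(1)]
    by (meson ordIso_iff_ordLeq ordLeq_transitive)
qed

text \<open>
  Points added at stage \<open>i\<close> are tagged with \<open>i\<close>, which keeps them apart from the earlier ones.
\<close>

lemma sparse_decomposition:
  obtains S where "universe M = (\<Union>i\<in>Field k. S i)"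
    "\<And>i p. i \<in> Field k \<Longrightarrow> p \<in> universe M \<Longrightarrow> left_isolated M (S i) p"
proof -
  define Q where "Q i W N \<longleftrightarrow> universe N \<subseteq> under k i \<times> UNIV \<and>
    (\<forall>p\<in>universe W. left_isolated N (universe W) p)" for i and W N :: "('k \<times> 'l) ostruct"
  obtain N where N: "\<And>i. i \<in> Field k \<Longrightarrow> good_stage empty_struct Q N i (N i)"
    "\<And>i. i \<in> Field k \<Longrightarrow> substr (N i) (union_struct (Field k) N)"
    "lin (union_struct (Field k) N)"
    "isomorphic (union_struct (Field k) N) M"
  proof (rule chain_exists[OF empty_struct(1,4), of Q])
    fix i and N :: "'k \<Rightarrow> ('k \<times> 'l) ostruct"
    assume i: "i \<in> Field k" and linW: "lin (stage empty_struct N i)"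
      and card: "|universe (stage empty_struct N i)| \<le>o l"
      and g: "\<And>j. j \<in> underS k i \<Longrightarrow> good_stage empty_struct Q N j (N j)"
    define W where "W = stage empty_struct N i"
    note linW = linW[folded W_def] and card = card[folded W_def]
    have Wsub: "universe W \<subseteq> underS k i \<times> UNIV"
    proof
      fix x assume "x \<in> universe W"
      then obtain j where j: "j \<in> underS k i" "x \<in> universe (N j)"
        by (auto simp: W_def universe_stage empty_struct(2))
      then have "x \<in> under k j \<times> UNIV" using g[OF j(1)] by (auto simp: good_stage_def Q_def)
      moreover have "under k j \<subseteq> underS k i"
        using j(1) k_trans k_antisym by (auto simp: under_def underS_def)
      ultimately show "x \<in> underS k i \<times> UNIV" by auto
    qed
    \<comment> \<open>Every point is doubled and \<open>W\<close> is embedded as the upper copies.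
      The lower copy \<open>(w, False)\<close> then witnesses that \<open>W\<close> does not
      approach \<open>w\<close> from below.\<close>
    define Y where "Y = \<lparr>universe = universe W \<times> (UNIV :: bool set),
      lt = {(p, q). p \<in> universe W \<times> UNIV \<and> q \<in> universe W \<times> UNIV \<and>
        ((fst p, fst q) \<in> lt W \<or> fst p = fst q \<and> \<not> snd p \<and> snd q)}\<rparr>"
    have Ysel: "universe Y = universe W \<times> UNIV"
      "\<And>x b y c. ((x, b), (y, c)) \<in> lt Y \<longleftrightarrow> x \<in> universe W \<and> y \<in> universe W \<and>
        ((x, y) \<in> lt W \<or> x = y \<and> \<not> b \<and> c)"
      by (auto simp: Y_def)
    have linY: "lin Y"
    proof (rule linI)
      fix p q r assume "(p, q) \<in> lt Y" "(q, r) \<in> lt Y"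
      then show "(p, r) \<in> lt Y"
        using lin_trans[OF linW, of "fst p" "fst q" "fst r"]
        by (cases p; cases q; cases r) (auto simp: Ysel)
    next
      fix p q assume "p \<in> universe Y" "q \<in> universe Y" "p \<noteq> q"
      then show "(p, q) \<in> lt Y \<or> (q, p) \<in> lt Y"
        using lin_total[OF linW, of "fst p" "fst q"] by (cases p; cases q) (auto simp: Ysel)
    qed (use lin_irrefl[OF linW] in \<open>auto simp: Y_def\<close>)
    have "|universe Y| \<le>o l"
      unfolding Ysel by (intro Times_le card finite_le finite)
    then obtain G where G: "ord_emb G Y M" using lin_embeds[OF linY] by blast
    have e: "ord_emb (\<lambda>w. (w, True)) W Y" by (auto simp: ord_emb_def Ysel)
    have V: "({i} \<times> Field l) \<inter> universe W = {}" using Wsub by (auto simp: underS_def)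
    have V2: "|universe M| \<le>o |{i} \<times> Field l|"
      using fresh_card[of "\<lambda>x. x" i] by simp
    obtain X \<phi> where X: "bij_betw \<phi> (universe M) (universe X)" "ord_emb \<phi> M X" "lin X"
      "\<And>w. w \<in> universe W \<Longrightarrow> \<phi> (G (w, True)) = w" "universe X \<subseteq> universe W \<union> {i} \<times> Field l"
      "substr W X"
      by (rule transport[OF M_lin linY linW G e V V2]) (rule that; assumption)
    have \<phi>G: "ord_emb (\<lambda>y. \<phi> (G y)) Y X" by (rule ord_emb_comp[OF G X(2)])
    have "left_isolated X (universe W) p" if p: "p \<in> universe W" for p
    proof -
      let ?A = "universe W \<times> {True}"
      have "seg Y (p, False) (p, True) \<inter> ?A = {}"
        using lin_irrefl[OF linW] by (auto simp: seg_def Ysel dest: lin_asym[OF linW])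
      moreover have "((p, False), (p, True)) \<in> lt Y" using p by (simp add: Ysel)
      ultimately have "left_isolated Y ?A (p, True)" unfolding left_isolated_def by blast
      then have "left_isolated X ((\<lambda>y. \<phi> (G y)) ` ?A) (\<phi> (G (p, True)))"
        using p by (intro left_isolated_emb[OF \<phi>G linY X(3)]) (auto simp: Ysel)
      moreover have "(\<lambda>y. \<phi> (G y)) ` ?A = universe W" using X(4) by force
      ultimately show ?thesis using X(4)[OF p] by simp
    qed
    moreover have "universe X \<subseteq> under k i \<times> UNIV"
      using X(5) Wsub by (auto simp: under_eq[OF i])
    ultimately have "good_stage empty_struct Q N i X"
      using X(3,6) isomorphic_sym[OF isomorphicI[OF X(1,2)]]
      by (auto simp: good_stage_def Q_def W_def)
    then show "\<exists>X. good_stage empty_struct Q N i X" by blast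
  qed blast
  let ?U = "union_struct (Field k) N"
  obtain f where f: "bij_betw f (universe ?U) (universe M)" "ord_emb f ?U M"
    using N(4) by (rule isomorphicE)
  have fU: "f ` universe ?U = universe M" using f(1) by (simp add: bij_betw_def)
  show thesis
  proof (rule that[of "\<lambda>i. f ` universe (N i)"])
    show "universe M = (\<Union>i\<in>Field k. f ` universe (N i))"
      unfolding fU[symmetric] by (simp add: image_UN)
    fix i p assume i: "i \<in> Field k" and "p \<in> universe M"
    then obtain u a where u: "p = f u" "a \<in> Field k" "u \<in> universe (N a)"
      unfolding fU[symmetric] by auto
    \<comment> \<open>The index \<open>n\<close> found here lies beyond both \<open>i\<close> and
      the stage \<open>a\<close> where \<open>u\<close> appears. Member \<open>n\<close> isolates
      \<open>u\<close> from all earlier points, in particular from those of \<open>N i\<close>, and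
      embeddings preserve this.\<close>
    obtain m where m: "m \<in> Field k" "(i, m) \<in> k" "(a, m) \<in> k"
      using k_total[OF i u(2)] k_refl i u(2) by blast
    obtain n where n: "n \<in> Field k" "m \<noteq> n" "(m, n) \<in> k" using k_limit[OF m(1)] by blast
    have "i \<in> underS k n" "a \<in> underS k n"
      using m n k_trans k_antisym unfolding underS_def by blast+
    then have sub: "universe (N i) \<subseteq> universe (stage empty_struct N n)"
      "u \<in> universe (stage empty_struct N n)"
      using u(3) by (auto simp: universe_stage)
    have g: "lin (N n)" "left_isolated (N n) (universe (stage empty_struct N n)) u"
      "substr (stage empty_struct N n) (N n)"
      using N(1)[OF n(1)] sub(2) by (auto simp: good_stage_def Q_def)
    have inN: "universe (N i) \<subseteq> universe (N n)" "u \<in> universe (N n)"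
      using sub ord_emb_mem[OF g(3)] by auto
    have e: "ord_emb f (N n) M" by (rule ord_emb_comp[OF N(2)[OF n(1)] f(2)])
    show "left_isolated M (f ` universe (N i)) p"
      unfolding u(1)
      by (rule left_isolated_emb[OF e g(1) M_lin inN left_isolated_mono[OF g(2) sub(1)]])
  qed
qed

section \<open>Embedding an order without destroying chosen least upper bounds\<close>

text \<open>
  Stage \<open>i\<close> of the chain contains exactly \<open>T i\<close> from \<open>Y\<close>, and the remaining elements of \<open>Y\<close> are later
  put above every point of stage \<open>i\<close> in the same cut of \<open>T i\<close>.
\<close>

lemma embed_cofinal:
  fixes Y :: "'y ostruct"
  assumes Y: "lin Y" "|universe Y| \<le>o l" and T: "universe Y = (\<Union>i\<in>Field k. T i)"
    and Tmono: "\<And>i j. (i, j) \<in> k \<Longrightarrow> T i \<subseteq> T j"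
  obtains g where "ord_emb g Y M"
    "\<And>p x. p \<in> universe Y \<Longrightarrow> \<forall>i\<in>Field k. left_isolated Y (T i) p \<Longrightarrow>
      (x, g p) \<in> lt M \<Longrightarrow> \<exists>y. (y, p) \<in> lt Y \<and> (x, g y) \<in> lt M"
proof -
  define In :: "'y \<Rightarrow> 'y + 'k \<times> 'l" where "In = Inl"
  have In_inj: "In x = In y \<longleftrightarrow> x = y" for x y by (simp add: In_def)
  define T' where "T' i = (\<Union>j\<in>underS k i. T j)" for i
  \<comment> \<open>The last clause mirrors the conclusion of \<open>amalgam\<close>: an element of
    \<open>Y\<close> entering now lies below an old point only if an old element of \<open>Y\<close>
    forces it.\<close>
  define EQ where "EQ i W N \<longleftrightarrow> universe N \<inter> range In = In ` T i \<and>
    universe N \<subseteq> range In \<union> Inr ` (under k i \<times> UNIV) \<and>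
    (\<forall>x\<in>T i. \<forall>y\<in>T i. (x, y) \<in> lt Y \<longrightarrow> (In x, In y) \<in> lt N) \<and>
    (\<forall>d\<in>T i. In d \<notin> universe W \<longrightarrow> (\<forall>x\<in>universe W. (In d, x) \<in> lt N \<longrightarrow>
      (\<exists>c. In c \<in> universe W \<and> (d, c) \<in> lt Y \<and> (In c = x \<or> (In c, x) \<in> lt N))))"
    for i and W N :: "('y + 'k \<times> 'l) ostruct"
  have TY: "T i \<subseteq> universe Y" if "i \<in> Field k" for i using T that by blast
  have uF: "j \<in> Field k" if "j \<in> underS k i" for i j using that by (auto simp: underS_def Field_def)
  have T'T: "T' i \<subseteq> T i" for i using Tmono unfolding T'_def underS_def by blast
  have W_In: "universe (stage empty_struct N i) \<inter> range In = In ` T' i"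
    if g: "\<And>j. j \<in> underS k i \<Longrightarrow> good_stage empty_struct EQ N j (N j)" for N i
  proof -
    have "universe (stage empty_struct N i) \<inter> range In = (\<Union>j\<in>underS k i. universe (N j) \<inter> range In)"
      by (auto simp: universe_stage empty_struct)
    also have "\<dots> = (\<Union>j\<in>underS k i. In ` T j)"
      using g by (intro SUP_cong) (auto simp: good_stage_def EQ_def)
    finally show ?thesis by (auto simp: T'_def)
  qed
  obtain N where N: "\<And>i. i \<in> Field k \<Longrightarrow> good_stage empty_struct EQ N i (N i)"
    "\<And>i j. (i, j) \<in> k \<Longrightarrow> substr (N i) (N j)"
    "\<And>i. i \<in> Field k \<Longrightarrow> substr (N i) (union_struct (Field k) N)"
    "lin (union_struct (Field k) N)"
    "isomorphic (union_struct (Field k) N) M"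
  proof (rule chain_exists[OF empty_struct(1,4), of EQ])
    fix i and N :: "'k \<Rightarrow> ('y + 'k \<times> 'l) ostruct"
    assume i: "i \<in> Field k" and linW: "lin (stage empty_struct N i)"
      and card: "|universe (stage empty_struct N i)| \<le>o l"
      and g: "\<And>j. j \<in> underS k i \<Longrightarrow> good_stage empty_struct EQ N j (N j)"
      and sub: "\<And>j. j \<in> underS k i \<Longrightarrow> substr (N j) (stage empty_struct N i)"
    define W where "W = stage empty_struct N i"
    note linW = linW[folded W_def] and card = card[folded W_def] and sub = sub[folded W_def]
    have WIn: "universe W \<inter> range In = In ` T' i" unfolding W_def by (rule W_In[OF g])
    have Wsub: "universe W \<subseteq> range In \<union> Inr ` (underS k i \<times> UNIV)"
    proof
      fix x assume "x \<in> universe W"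
      then obtain j where j: "j \<in> underS k i" "x \<in> universe (N j)"
        by (auto simp: W_def universe_stage empty_struct(2))
      then have "x \<in> range In \<union> Inr ` (under k j \<times> UNIV)"
        using g[OF j(1)] unfolding good_stage_def EQ_def by blast
      moreover have "under k j \<subseteq> underS k i"
        using j(1) k_trans k_antisym by (auto simp: under_def underS_def)
      ultimately show "x \<in> range In \<union> Inr ` (underS k i \<times> UNIV)" by blast
    qed
    \<comment> \<open>The elements of \<open>Y\<close> due at stage \<open>i\<close>. Those in
      \<open>T' i\<close> are already in \<open>W\<close>, in the right order, and form the common
      part over which to amalgamate.\<close>
    define Ti where "Ti = \<lparr>universe = T i, lt = {(x, y). x \<in> T i \<and> y \<in> T i \<and> (x, y) \<in> lt Y}\<rparr>"
    have linTi: "lin Ti"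
      using lin_pullback(1)[OF Y(1), of "\<lambda>x. x" "T i"] TY[OF i] by (simp add: Ti_def)
    define E where "E = image_struct In Ti"
    have inj: "inj_on In A" for A by (simp add: inj_on_def In_inj)
    have linE: "lin E" unfolding E_def by (rule lin_image_struct[OF linTi inj])
    have uE: "universe E = In ` T i" by (simp add: E_def image_struct_def Ti_def)
    have ltE: "(In x, In y) \<in> lt E \<longleftrightarrow> (x, y) \<in> lt Y" if "x \<in> T i" "y \<in> T i" for x y
      using image_struct_less[OF linTi inj, of x y] that unfolding E_def Ti_def by simp
    have WE: "universe W \<inter> universe E = In ` T' i"
      using WIn T'T[of i] unfolding uE by blast
    have ltW: "(In x, In y) \<in> lt W" if xy: "x \<in> T' i" "y \<in> T' i" "(x, y) \<in> lt Y" for x y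
    proof -
      obtain a b where ab: "a \<in> underS k i" "x \<in> T a" "b \<in> underS k i" "y \<in> T b"
        using xy(1,2) by (auto simp: T'_def)
      obtain c where c: "c \<in> underS k i" "x \<in> T c" "y \<in> T c"
        using k_total[OF uF[OF ab(1)] uF[OF ab(3)]] ab Tmono by blast
      then have "(In x, In y) \<in> lt (N c)"
        using g[OF c(1)] xy(3) by (auto simp: good_stage_def EQ_def)
      then show ?thesis using ord_emb_lessD[OF sub[OF c(1)]] g[OF c(1)] by (simp add: good_stage_def)
    qed
    have agree: "(x, y) \<in> lt W \<longleftrightarrow> (x, y) \<in> lt E"
      if xy: "x \<in> universe W \<inter> universe E" "y \<in> universe W \<inter> universe E" for x y
    proof -
      obtain a b where ab: "x = In a" "y = In b" "a \<in> T' i" "b \<in> T' i" using xy unfolding WE by blast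
      have ab': "a \<in> T i" "b \<in> T i" using ab T'T by blast+
      consider "(a, b) \<in> lt Y" | "a = b" | "(b, a) \<in> lt Y"
        using lin_total[OF Y(1), of a b] ab' TY[OF i] by blast
      then show ?thesis
      proof cases
        case 1 then show ?thesis using ltW ltE ab ab' by simp
      next
        case 2 then show ?thesis using lin_irrefl[OF linW] lin_irrefl[OF linE] ab by simp
      next
        case 3
        then show ?thesis
          using lin_asym[OF linW ltW[OF ab(4,3) 3]] lin_asym[OF Y(1) 3] ltE[OF ab'] ab by simp
      qed
    qed
    obtain Z where Z: "lin Z" "universe Z = universe W \<union> universe E" "substr W Z" "substr E Z"
      "\<And>d x. d \<in> universe E - universe W \<Longrightarrow> x \<in> universe W \<Longrightarrow> (d, x) \<in> lt Z \<Longrightarrow>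
        \<exists>c\<in>universe W \<inter> universe E. (d, c) \<in> lt E \<and> (c = x \<or> (c, x) \<in> lt W)"
      using amalgam[OF linW linE agree] by metis
    have "|universe Z| \<le>o l"
      unfolding Z(2) uE by (intro Un_le card image_le subset_le[OF TY[OF i] Y(2)])
    then obtain G where G: "ord_emb G Z M" using lin_embeds[OF Z(1)] by blast
    have V: "(Inr ` ({i} \<times> Field l)) \<inter> universe Z = {}"
      using Wsub unfolding Z(2) uE In_def by (auto simp: underS_def)
    have V2: "|universe M| \<le>o |Inr ` ({i} \<times> Field l) :: ('y + 'k \<times> 'l) set|"
      by (rule fresh_card) simp
    obtain X \<phi> where X: "bij_betw \<phi> (universe M) (universe X)" "ord_emb \<phi> M X" "lin X"
      "universe X \<subseteq> universe Z \<union> Inr ` ({i} \<times> Field l)" "substr Z X"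
      by (rule transport[OF M_lin Z(1) Z(1) G ord_emb_refl V V2]) (rule that; assumption)
    have "substr W X" "substr E X"
      using ord_emb_comp[OF Z(3) X(5)] ord_emb_comp[OF Z(4) X(5)] by simp_all
    have "EQ i W X"
      unfolding EQ_def
    proof (intro conjI ballI impI)
      have "universe X \<inter> range In \<subseteq> universe W \<inter> range In \<union> In ` T i"
        using X(4) unfolding Z(2) uE In_def by blast
      then have "universe X \<inter> range In \<subseteq> In ` T i"
        using T'T[of i] unfolding WIn by blast
      moreover have "In ` T i \<subseteq> universe X \<inter> range In"
        using ord_emb_mem[OF \<open>substr E X\<close>] unfolding uE by blast
      ultimately show "universe X \<inter> range In = In ` T i" by blast
      have "underS k i \<subseteq> under k i" "i \<in> under k i" by (simp_all add: under_eq[OF i]) blast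
      then show "universe X \<subseteq> range In \<union> Inr ` (under k i \<times> UNIV)"
        using X(4) Wsub unfolding Z(2) uE by blast
      show "(In x, In y) \<in> lt X" if "x \<in> T i" "y \<in> T i" "(x, y) \<in> lt Y" for x y
        using ord_emb_lessD[OF \<open>substr E X\<close> linE] ltE[OF that(1,2)] that(3) by simp
      fix d x assume d: "d \<in> T i" "In d \<notin> universe W" and x: "x \<in> universe W" "(In d, x) \<in> lt X"
      have "(In d, x) \<in> lt Z"
        using ord_emb_less[OF X(5)] x d(1) unfolding Z(2) uE by blast
      then obtain c where c: "c \<in> universe W \<inter> universe E" "(In d, c) \<in> lt E" "c = x \<or> (c, x) \<in> lt W"
        using Z(5)[of "In d" x] d x(1) unfolding uE by blast
      then obtain b where b: "c = In b" "b \<in> T i" unfolding uE by blast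
      have "(d, b) \<in> lt Y" using c(2) b ltE d(1) by simp
      moreover have "In b = x \<or> (In b, x) \<in> lt X"
        using c(3) b ord_emb_lessD[OF \<open>substr W X\<close> linW] by blast
      ultimately show "\<exists>c. In c \<in> universe W \<and> (d, c) \<in> lt Y \<and> (In c = x \<or> (In c, x) \<in> lt X)"
        using c(1) b by blast
    qed
    then have "good_stage empty_struct EQ N i X"
      using X(3) \<open>substr W X\<close> isomorphic_sym[OF isomorphicI[OF X(1,2)]]
      by (auto simp: good_stage_def W_def)
    then show "\<exists>X. good_stage empty_struct EQ N i X" by blast
  qed blast
  let ?U = "union_struct (Field k) N"
  have InU: "In y \<in> universe ?U" if "y \<in> universe Y" for y
    using N(1) that unfolding T good_stage_def EQ_def by fastforce
  have eIn: "ord_emb In Y ?U"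
  proof (rule ord_embI[OF Y(1) N(4) InU])
    fix x y assume xy: "(x, y) \<in> lt Y"
    obtain a b where ab: "a \<in> Field k" "x \<in> T a" "b \<in> Field k" "y \<in> T b"
      using lin_dom[OF Y(1) xy] by (auto simp: T)
    obtain c where c: "c \<in> Field k" "x \<in> T c" "y \<in> T c"
      using k_total[OF ab(1,3)] ab Tmono by blast
    have "(In x, In y) \<in> lt (N c)"
      using N(1)[OF c(1)] c xy by (auto simp: good_stage_def EQ_def)
    then show "(In x, In y) \<in> lt ?U" using c(1) by auto
  qed
  have NIn: "universe (N i) \<inter> range In = In ` T i" if "i \<in> Field k" for i
    using N(1)[OF that] by (simp add: good_stage_def EQ_def)
  have NT: "y \<in> T i" if "In y \<in> universe (N i)" "i \<in> Field k" for y i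
  proof -
    have "In y \<in> In ` T i" using that(1) unfolding NIn[OF that(2), symmetric] by simp
    then show ?thesis using In_inj by auto
  qed
  have TN: "In y \<in> universe (N i)" if "y \<in> T i" "i \<in> Field k" for y i
    using NIn[OF that(2)] that(1) by blast
  \<comment> \<open>The last clause of \<open>EQ\<close>, propagated along the chain: whatever puts
    \<open>d\<close> below a point of stage \<open>i\<close> is already visible in
    \<open>T i\<close>. The induction is on a stage \<open>m\<close> at which \<open>d\<close> is
    present.\<close>
  have key: "\<exists>c\<in>T i. (d, c) \<in> lt Y \<and> (In c = x \<or> (In c, x) \<in> lt ?U)"
    if i: "i \<in> Field k" "x \<in> universe (N i)" and d: "d \<notin> T i" "(In d, x) \<in> lt ?U"
      and m: "m \<in> Field k" "d \<in> T m" for i x d m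
    using k_wf m d
  proof (induction m arbitrary: d rule: wf_induct_rule)
    case (less m)
    show ?case
    proof (cases "\<exists>j\<in>underS k m. d \<in> T j")
      case True
      then obtain j where j: "j \<in> underS k m" "d \<in> T j" by blast
      then have "(j, m) \<in> k - Id" by (auto simp: underS_def)
      from less.IH[OF this uF[OF j(1)] j(2) less.prems(3,4)] show ?thesis .
    next
      case False
      \<comment> \<open>Now \<open>d\<close> enters at \<open>m\<close>, where \<open>x\<close> is
        an old point, so \<open>EQ\<close> supplies a \<open>c\<close> that entered before
        \<open>m\<close>. Either \<open>c\<close> is in \<open>T i\<close>, or \<open>c\<close> is
        \<open>d\<close>'s replacement in the induction hypothesis.\<close>
      have "(i, m) \<in> k \<and> i \<noteq> m" using k_total[OF i(1) less.prems(1)] less.prems(2,3) Tmono by blast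
      then have im: "i \<in> underS k m" by (simp add: underS_def)
      let ?W = "stage empty_struct N m"
      have g: "good_stage empty_struct EQ N m (N m)" using N(1) less.prems(1) by blast
      have WIn: "universe ?W \<inter> range In = In ` T' m" using W_In N(1) uF by blast
      have W_T: "\<exists>j\<in>underS k m. y \<in> T j" if "In y \<in> universe ?W" for y
      proof -
        have "In y \<in> In ` T' m" using that unfolding WIn[symmetric] by simp
        then show ?thesis using In_inj unfolding T'_def by auto
      qed
      have "In d \<notin> universe ?W" using W_T False by blast
      moreover have xW: "x \<in> universe ?W" using im i(2) by (auto simp: universe_stage)
      moreover have "(In d, x) \<in> lt (N m)"
        using ord_emb_less[OF N(3)[OF less.prems(1)]] less.prems(4) TN[OF less.prems(2,1)]
          ord_emb_mem[of _ ?W "N m" x] g xW unfolding good_stage_def by blast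
      ultimately obtain c where c: "In c \<in> universe ?W" "(d, c) \<in> lt Y" "In c = x \<or> (In c, x) \<in> lt (N m)"
        using g less.prems(2) unfolding good_stage_def EQ_def by blast
      have cx: "In c = x \<or> (In c, x) \<in> lt ?U" using c(3) less.prems(1) by auto
      show ?thesis
      proof (cases "c \<in> T i")
        case False
        then have "(In c, x) \<in> lt ?U" using cx NT i by blast
        moreover obtain j where j: "j \<in> underS k m" "c \<in> T j"
          using W_T[OF c(1)] by blast
        moreover from j have "(j, m) \<in> k - Id" by (auto simp: underS_def)
        ultimately obtain c' where "c' \<in> T i" "(c, c') \<in> lt Y" "In c' = x \<or> (In c', x) \<in> lt ?U"
          using less.IH[OF _ uF[OF j(1)] j(2) False] by blast
        then show ?thesis using lin_trans[OF Y(1) c(2)] by blast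
      qed (use c cx in blast)
    qed
  qed
  obtain f where f: "bij_betw f (universe ?U) (universe M)" "ord_emb f ?U M"
    using N(5) by (rule isomorphicE)
  show thesis
  proof (rule that[of "\<lambda>y. f (In y)"])
    show "ord_emb (\<lambda>y. f (In y)) Y M" by (rule ord_emb_comp[OF eIn f(2)])
    fix p x assume p: "p \<in> universe Y" and iso: "\<forall>i\<in>Field k. left_isolated Y (T i) p"
      and x: "(x, f (In p)) \<in> lt M"
    obtain u where u: "u \<in> universe ?U" "x = f u"
      using lin_dom(1)[OF M_lin x] f(1) unfolding bij_betw_def by blast
    then obtain i where i: "i \<in> Field k" "u \<in> universe (N i)" by auto
    have up: "(u, In p) \<in> lt ?U" using ord_emb_less[OF f(2) u(1) InU[OF p]] x u(2) by simp
    \<comment> \<open>\<open>q\<close> is the required point. It differs from \<open>u\<close>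
      because it is outside \<open>T i\<close>; and if it were below \<open>u\<close>,
      \<open>key\<close> would put an element of \<open>T i\<close> between \<open>q\<close> and
      \<open>p\<close>, where there is none.\<close>
    obtain q where q: "(q, p) \<in> lt Y" "seg Y q p \<inter> T i = {}"
      using iso i(1) unfolding left_isolated_def by blast
    have qY: "q \<in> universe Y" using lin_dom[OF Y(1) q(1)] by simp
    have "q \<in> seg Y q p" using q(1) by (simp add: seg_def)
    then have qT: "q \<notin> T i" using q(2) by blast
    have "u \<noteq> In q" using qT NT[OF _ i(1)] i(2) by blast
    moreover have "(In q, u) \<notin> lt ?U"
    proof
      assume qu: "(In q, u) \<in> lt ?U"
      obtain m where m: "m \<in> Field k" "q \<in> T m" using qY unfolding T by blast
      obtain c where c: "c \<in> T i" "(q, c) \<in> lt Y" "In c = u \<or> (In c, u) \<in> lt ?U"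
        using key[OF i qT qu m] by blast
      then have "(In c, In p) \<in> lt ?U" using up lin_trans[OF N(4)] by blast
      then have "(c, p) \<in> lt Y" using ord_emb_less[OF eIn] c(1) TY[OF i(1)] p by blast
      then show False using c q(2) unfolding seg_def by blast
    qed
    ultimately have "(u, In q) \<in> lt ?U" using lin_total[OF N(4) u(1) InU[OF qY]] by blast
    then show "\<exists>y. (y, p) \<in> lt Y \<and> (x, f (In y)) \<in> lt M"
      using q(1) u ord_emb_lessD[OF f(2) N(4)] by blast
  qed
qed

end

section \<open>Adding least upper bounds\<close>

text \<open>In a linear order this says that \<open>p\<close> is the least upper bound of
  \<open>A\<close> and not an element of \<open>A\<close>.\<close>

definition strict_lub :: "'a ostruct \<Rightarrow> 'a set \<Rightarrow> 'a \<Rightarrow> bool" where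
  "strict_lub N A p \<longleftrightarrow> p \<in> universe N \<and> (\<forall>a\<in>A. (a, p) \<in> lt N) \<and>
     (\<forall>x. (x, p) \<in> lt N \<longrightarrow> (\<exists>a\<in>A. (x, a) \<in> lt N))"

text \<open>An embedding can destroy a least upper bound by placing new points between the set and
  its bound. The last hypothesis prevents this; it has the form that \<open>embed_cofinal\<close>
  provides.\<close>

lemma strict_lub_emb:
  assumes f: "ord_emb f N N'" "lin N" "lin N'" and p: "strict_lub N A p"
    and cof: "\<And>x. (x, f p) \<in> lt N' \<Longrightarrow> \<exists>y. (y, p) \<in> lt N \<and> (x, f y) \<in> lt N'"
  shows "strict_lub N' (f ` A) (f p)"
  unfolding strict_lub_def
proof (intro conjI ballI allI impI)
  show "f p \<in> universe N'" using ord_emb_mem[OF f(1)] p by (simp add: strict_lub_def)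
  show "(b, f p) \<in> lt N'" if "b \<in> f ` A" for b
    using that p ord_emb_lessD[OF f(1,2)] unfolding strict_lub_def by blast
  fix x assume "(x, f p) \<in> lt N'"
  then obtain y where y: "(y, p) \<in> lt N" "(x, f y) \<in> lt N'" using cof by blast
  then obtain a where "a \<in> A" "(y, a) \<in> lt N" using p unfolding strict_lub_def by blast
  then show "\<exists>b\<in>f ` A. (x, b) \<in> lt N'"
    using y(2) ord_emb_lessD[OF f(1,2)] lin_trans[OF f(3)] by blast
qed

lemma strict_lub_iso:
  assumes f: "bij_betw f (universe N) (universe N')" "ord_emb f N N'" "lin N" "lin N'"
    and p: "strict_lub N A p"
  shows "strict_lub N' (f ` A) (f p)"
proof (rule strict_lub_emb[OF f(2-4) p])
  fix x assume x: "(x, f p) \<in> lt N'"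
  then obtain u where u: "u \<in> universe N" "x = f u"
    using lin_dom[OF f(4)] f(1) unfolding bij_betw_def by blast
  have pN: "p \<in> universe N" using p by (simp add: strict_lub_def)
  then have "(u, p) \<in> lt N" using x u ord_emb_less[OF f(2)] by blast
  then obtain a where a: "a \<in> A" "(u, a) \<in> lt N" using p unfolding strict_lub_def by blast
  then show "\<exists>y. (y, p) \<in> lt N \<and> (x, f y) \<in> lt N'"
    using u(2) p ord_emb_lessD[OF f(2,3)] unfolding strict_lub_def by blast
qed

text \<open>A point below \<open>p\<close> in the union is below \<open>p\<close> in a member where
  \<open>p\<close> is a least upper bound, and that member has an element of \<open>A\<close> above
  it.\<close>

lemma strict_lub_union:
  assumes sub: "\<And>m. m \<in> I \<Longrightarrow> lt (N m) \<subseteq> lt S" "\<And>m. m \<in> I \<Longrightarrow> universe (N m) \<subseteq> universe S"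
    and lub: "m \<in> I" "strict_lub (N m) A p"
    and sup: "\<And>x. (x, p) \<in> lt S \<Longrightarrow> \<exists>m\<in>I. (x, p) \<in> lt (N m) \<and> strict_lub (N m) A p"
  shows "strict_lub S A p"
  unfolding strict_lub_def
proof (intro conjI ballI allI impI)
  show "p \<in> universe S" using sub(2) lub unfolding strict_lub_def by blast
  show "(a, p) \<in> lt S" if "a \<in> A" for a using sub(1) lub that unfolding strict_lub_def by blast
  fix x assume "(x, p) \<in> lt S"
  then obtain n where "n \<in> I" "(x, p) \<in> lt (N n)" "strict_lub (N n) A p" using sup by blast
  then show "\<exists>a\<in>A. (x, a) \<in> lt S" using sub(1) unfolding strict_lub_def by blast
qed

text \<open>
  \<open>Y\<close> consists of initial segments of \<open>W\<close>. Sets that have a least upper bound already get no new one: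
  it would separate them from the old one.
\<close>

lemma add_lubs:
  fixes W :: "'b ostruct" and F :: "'b set set"
  assumes W: "lin W" and F: "\<And>A. A \<in> F \<Longrightarrow> A \<subseteq> universe W"
    "\<And>A a. A \<in> F \<Longrightarrow> a \<in> A \<Longrightarrow> \<exists>b\<in>A. (a, b) \<in> lt W"
  obtains Y :: "'b set ostruct" and e h where "lin Y" "ord_emb e W Y"
    "universe Y \<subseteq> e ` universe W \<union> h ` F"
    "\<And>A. A \<in> F \<Longrightarrow> \<exists>p. strict_lub Y (e ` A) p"
    "\<And>A p. A \<in> F \<Longrightarrow> strict_lub W A p \<Longrightarrow> strict_lub Y (e ` A) (e p)"
proof -
  note Wt = lin_trans[OF W]
  define dn where "dn A = {x. \<exists>a\<in>A. x = a \<or> (x, a) \<in> lt W}" for A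
  \<comment> \<open>Points become principal initial segments, sets in \<open>F\<close> without a
    bound become their downward closures, and inclusion orders both kinds linearly.\<close>
  define e where "e w = dn {w}" for w
  have e: "x \<in> e w \<longleftrightarrow> x = w \<or> (x, w) \<in> lt W" for x w by (simp add: e_def dn_def)
  define Y where "Y = \<lparr>universe = e ` universe W \<union> dn ` {A \<in> F. \<nexists>p. strict_lub W A p},
    lt = {(S, T). S \<in> e ` universe W \<union> dn ` {A \<in> F. \<nexists>p. strict_lub W A p} \<and>
      T \<in> e ` universe W \<union> dn ` {A \<in> F. \<nexists>p. strict_lub W A p} \<and> S \<subset> T}\<rparr>"
  have ltY: "(S, T) \<in> lt Y \<longleftrightarrow> S \<in> universe Y \<and> T \<in> universe Y \<and> S \<subset> T" for S T
    by (simp add: Y_def)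
  have eY: "e w \<in> universe Y" if "w \<in> universe W" for w using that by (simp add: Y_def)
  have rep: "\<exists>A. A \<subseteq> universe W \<and> S = dn A" if S: "S \<in> universe Y" for S
  proof -
    consider w where "w \<in> universe W" "S = dn {w}" | A where "A \<in> F" "S = dn A"
      using S by (auto simp: Y_def e_def)
    then show ?thesis by cases (use F(1) in auto)
  qed
  have down: "x \<in> S" if S: "S \<in> universe Y" and xy: "y \<in> S" "(x, y) \<in> lt W" for S x y
  proof -
    obtain A where "S = dn A" using rep[OF S] by blast
    then show ?thesis using xy Wt[OF xy(2)] unfolding dn_def by blast
  qed
  have SW: "S \<subseteq> universe W" if S: "S \<in> universe Y" for S
    using rep[OF S] lin_dom[OF W] unfolding dn_def by blast
  have comp: "S \<subseteq> T \<or> T \<subseteq> S" if ST: "S \<in> universe Y" "T \<in> universe Y" for S T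
  proof (rule ccontr)
    assume "\<not> (S \<subseteq> T \<or> T \<subseteq> S)"
    then obtain x y where xy: "x \<in> S" "x \<notin> T" "y \<in> T" "y \<notin> S" by blast
    then have "(x, y) \<in> lt W \<or> (y, x) \<in> lt W"
      using lin_total[OF W, of x y] SW ST by blast
    then show False using down xy ST by blast
  qed
  have linY: "lin Y"
    by (rule linI) (use comp in \<open>auto simp: ltY\<close>)
  have eless: "(e x, e y) \<in> lt Y" if "(x, y) \<in> lt W" for x y
  proof -
    have "y \<notin> e x" using that lin_asym[OF W] lin_irrefl[OF W] by (auto simp: e)
    moreover have "e x \<subseteq> e y" using that Wt by (auto simp: e)
    moreover have "y \<in> e y" by (simp add: e)
    ultimately show ?thesis using eY lin_dom[OF W that] unfolding ltY by blast
  qed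
  have emb: "ord_emb e W Y" by (rule ord_embI[OF W linY eY eless])
  \<comment> \<open>Members of \<open>F\<close> have no last element: if \<open>S\<close> misses
    \<open>a\<close>, it lies within \<open>e a\<close>, hence properly within \<open>e b\<close>
    for a larger \<open>b\<close> in \<open>A\<close>.\<close>
  have below: "\<exists>b\<in>A. (S, e b) \<in> lt Y"
    if A: "A \<in> F" and S: "S \<in> universe Y" and a: "a \<in> A" "a \<notin> S" for A S a
  proof -
    obtain b where b: "b \<in> A" "(a, b) \<in> lt W" using F(2)[OF A a(1)] by blast
    have "a \<in> e a" by (simp add: e)
    then have "S \<subseteq> e a" using comp[OF S eY] a F(1)[OF A] by blast
    then have "S \<subset> e b" using eless[OF b(2)] unfolding ltY by blast
    then show ?thesis using b(1) S eY F(1)[OF A] unfolding ltY by blast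
  qed
  have old: "strict_lub Y (e ` A) (e p)" if A: "A \<in> F" and p: "strict_lub W A p" for A p
    unfolding strict_lub_def
  proof (intro conjI ballI allI impI)
    show "e p \<in> universe Y" using p eY by (simp add: strict_lub_def)
    show "(b, e p) \<in> lt Y" if "b \<in> e ` A" for b
      using that p eless unfolding strict_lub_def by blast
    fix S assume Sp: "(S, e p) \<in> lt Y"
    then have S: "S \<in> universe Y" "S \<subset> e p" by (simp_all add: ltY)
    have "\<exists>a\<in>A. a \<notin> S"
    proof (rule ccontr)
      assume "\<not> (\<exists>a\<in>A. a \<notin> S)"
      then have AS: "A \<subseteq> S" by blast
      have pS: "p \<notin> S" using S(2) down[OF S(1)] by (auto simp: e)
      have Sless: "(x, p) \<in> lt W" if x: "x \<in> S" for x
      proof -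
        have "x \<in> e p" "x \<noteq> p" using x S(2) pS by blast+
        then show ?thesis by (simp add: e)
      qed
      \<comment> \<open>A segment \<open>S\<close> that contains \<open>A\<close> but not
        \<open>p\<close> is not principal, since an element of \<open>A\<close> exceeds its
        generator. If it is the closure of some \<open>B\<close>, then \<open>p\<close> is a least
        upper bound of \<open>B\<close>, so no segment was added for \<open>B\<close>.\<close>
      consider w where "w \<in> universe W" "S = e w" | B where "B \<in> F" "S = dn B" "\<nexists>p. strict_lub W B p"
        using S(1) by (auto simp: Y_def)
      then show False
      proof cases
        case 1
        then have "(w, p) \<in> lt W" by (intro Sless) (simp add: e)
        then obtain a where a: "a \<in> A" "(w, a) \<in> lt W" using p unfolding strict_lub_def by blast
        then have "a \<in> e w" using AS 1(2) by blast
        then show False using lin_asym[OF W a(2)] lin_irrefl[OF W] a(2) by (auto simp: e)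
      next
        case 2
        have "strict_lub W B p"
          unfolding strict_lub_def
        proof (intro conjI ballI allI impI)
          show "p \<in> universe W" using p by (simp add: strict_lub_def)
          show "(b, p) \<in> lt W" if "b \<in> B" for b
            using that by (intro Sless) (auto simp: 2(2) dn_def)
          fix x assume "(x, p) \<in> lt W"
          then obtain a where a: "a \<in> A" "(x, a) \<in> lt W" using p unfolding strict_lub_def by blast
          then obtain b where "b \<in> B" "a = b \<or> (a, b) \<in> lt W" using AS 2(2) unfolding dn_def by blast
          then show "\<exists>b\<in>B. (x, b) \<in> lt W" using a(2) Wt by blast
        qed
        then show False using 2(3) by blast
      qed
    qed
    then show "\<exists>b\<in>e ` A. (S, b) \<in> lt Y" using below[OF A S(1)] by blast
  qed
  have new: "\<exists>p. strict_lub Y (e ` A) p" if A: "A \<in> F" for A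
  proof (cases "\<exists>p. strict_lub W A p")
    case True
    then show ?thesis using old[OF A] by blast
  next
    case False
    then have dY: "dn A \<in> universe Y" using A by (auto simp: Y_def)
    have dom: "a \<in> dn A" if "a \<in> A" for a using that by (auto simp: dn_def)
    have "strict_lub Y (e ` A) (dn A)"
      unfolding strict_lub_def
    proof (intro conjI ballI allI impI)
      fix b assume "b \<in> e ` A"
      then obtain a where a: "a \<in> A" "b = e a" by blast
      then obtain c where c: "c \<in> A" "(a, c) \<in> lt W" using F(2)[OF A] by blast
      have "e a \<subseteq> dn A" using a(1) by (auto simp: e dn_def)
      moreover have "c \<notin> e a" using c(2) lin_asym[OF W] lin_irrefl[OF W] by (auto simp: e)
      ultimately show "(b, dn A) \<in> lt Y"
        using dom[OF c(1)] dY eY F(1)[OF A] a unfolding ltY by blast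
    next
      fix S assume "(S, dn A) \<in> lt Y"
      then have S: "S \<in> universe Y" "S \<subset> dn A" by (simp_all add: ltY)
      then obtain z where "z \<in> dn A" "z \<notin> S" by blast
      then obtain a where "a \<in> A" "a \<notin> S" using down[OF S(1)] unfolding dn_def by blast
      then show "\<exists>b\<in>e ` A. (S, b) \<in> lt Y" using below[OF A S(1)] by blast
    qed (rule dY)
    then show ?thesis by blast
  qed
  show thesis
    by (rule that[OF linY emb _ new old, of dn]) (auto simp: Y_def)
qed

section \<open>The lexicographic order\<close>

context superlimit_order
begin

text \<open>\<open>Func\<close> fixes the values outside \<open>Field k\<close>, so functions that
  agree on \<open>Field k\<close> are equal.\<close>

definition fns :: "('k \<Rightarrow> 'k) set" where
  "fns = Func (Field k) (Field k)"

text \<open>The value at \<open>a\<close> is still free, and it is the first to decide the order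
  inside the cylinder.\<close>

definition cyl :: "('k \<Rightarrow> 'k) \<Rightarrow> 'k \<Rightarrow> ('k \<Rightarrow> 'k) set" where
  "cyl f a = {g \<in> fns. \<forall>b\<in>underS k a. g b = f b}"

definition lex_less :: "('k \<Rightarrow> 'k) \<Rightarrow> ('k \<Rightarrow> 'k) \<Rightarrow> 'k \<Rightarrow> bool" where
  "lex_less f g a \<longleftrightarrow> a \<in> Field k \<and> (\<forall>b\<in>underS k a. f b = g b) \<and> f a \<noteq> g a \<and> (f a, g a) \<in> k"

definition lex_struct :: "('k \<Rightarrow> 'k) ostruct" where
  "lex_struct = \<lparr>universe = fns, lt = {(f, g). f \<in> fns \<and> g \<in> fns \<and> (\<exists>a. lex_less f g a)}\<rparr>"

lemma lex_struct_sel [simp]: "universe lex_struct = fns"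
  "(f, g) \<in> lt lex_struct \<longleftrightarrow> f \<in> fns \<and> g \<in> fns \<and> (\<exists>a. lex_less f g a)"
  by (simp_all add: lex_struct_def)

lemma fns_val: "f \<in> fns \<Longrightarrow> a \<in> Field k \<Longrightarrow> f a \<in> Field k"
  by (auto simp: fns_def Func_def)

lemma fns_upd: "f \<in> fns \<Longrightarrow> a \<in> Field k \<Longrightarrow> m \<in> Field k \<Longrightarrow> f(a := m) \<in> fns"
  by (auto simp: fns_def Func_def)

lemma underS_trans: "b \<in> underS k a \<Longrightarrow> (a, c) \<in> k \<Longrightarrow> b \<in> underS k c"
  using k_trans k_antisym unfolding underS_def by blast

lemma underS_Field': "b \<in> underS k a \<Longrightarrow> b \<in> Field k"
  by (auto simp: underS_def Field_def)

lemma k_cases: "a \<in> Field k \<Longrightarrow> b \<in> Field k \<Longrightarrow> a = b \<or> a \<in> underS k b \<or> b \<in> underS k a"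
  using k_total unfolding underS_def by blast

lemma lin_lex_struct: "lin lex_struct"
proof (rule linI)
  fix f g h assume "(f, g) \<in> lt lex_struct" "(g, h) \<in> lt lex_struct"
  then obtain a b where fns: "f \<in> fns" "h \<in> fns" and a: "lex_less f g a" and b: "lex_less g h b"
    by auto
  have ab: "a \<in> Field k" "b \<in> Field k" using a b by (auto simp: lex_less_def)
  have "\<exists>c. lex_less f h c"
  proof -
    consider "a = b" | "a \<in> underS k b" | "b \<in> underS k a" using k_cases[OF ab] by blast
    then show ?thesis
    proof cases
      case 1
      then have "lex_less f h a"
        using a b k_trans[of "f a" "g a" "h a"] k_antisym[of "f a" "g a"]
        by (auto simp: lex_less_def)
      then show ?thesis by blast
    next
      case 2
      then have "(a, b) \<in> k" by (simp add: underS_def)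
      then have "underS k a \<subseteq> underS k b" using underS_trans by blast
      moreover have "g a = h a" using b 2 by (simp add: lex_less_def)
      ultimately have "lex_less f h a" using a b by (simp add: lex_less_def subset_iff)
      then show ?thesis by blast
    next
      case 3
      then have "(b, a) \<in> k" by (simp add: underS_def)
      then have "underS k b \<subseteq> underS k a" using underS_trans by blast
      moreover have "f b = g b" using a 3 by (simp add: lex_less_def)
      ultimately have "lex_less f h b" using a b by (simp add: lex_less_def subset_iff)
      then show ?thesis by blast
    qed
  qed
  then show "(f, h) \<in> lt lex_struct" using fns by simp
next
  fix f g assume fg: "f \<in> universe lex_struct" "g \<in> universe lex_struct" "f \<noteq> g"
  let ?D = "{a \<in> Field k. f a \<noteq> g a}"
  have "?D \<noteq> {}"
  proof
    assume "?D = {}"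
    then have "f a = g a" for a using fg(1,2) by (cases "a \<in> Field k") (auto simp: fns_def Func_def)
    then show False using fg(3) by auto
  qed
  then obtain z where "z \<in> ?D" by blast
  then obtain a where a: "a \<in> ?D" and min: "\<And>b. (b, a) \<in> k - Id \<Longrightarrow> b \<notin> ?D"
    by (rule wfE_min[OF k_wf]) (rule that; assumption)
  have "f b = g b" if b: "b \<in> underS k a" for b
  proof -
    have "(b, a) \<in> k - Id" using b by (simp add: underS_def)
    then show ?thesis using min underS_Field'[OF b] by blast
  qed
  then have "lex_less f g a \<or> lex_less g f a"
    using a k_total[of "f a" "g a"] fns_val fg(1,2) by (auto simp: lex_less_def)
  then show "(f, g) \<in> lt lex_struct \<or> (g, f) \<in> lt lex_struct" using fg by auto
qed (auto simp: lex_less_def)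

lemma cyl_self: "f \<in> fns \<Longrightarrow> f \<in> cyl f a"
  by (simp add: cyl_def)

lemma cyl_upd: "f \<in> fns \<Longrightarrow> a \<in> Field k \<Longrightarrow> m \<in> Field k \<Longrightarrow> f(a := m) \<in> cyl f a"
  using fns_upd by (auto simp: cyl_def underS_def)

lemma cyl_less:
  assumes "g \<in> cyl f a" "h \<in> cyl f a" "a \<in> Field k" "g a \<in> underS k (h a)"
  shows "(g, h) \<in> lt lex_struct"
  using assms by (auto simp: cyl_def lex_less_def underS_def)

lemma cyl_cong: "g \<in> cyl f a \<Longrightarrow> cyl g a = cyl f a"
  by (auto simp: cyl_def)

text \<open>Distinct cylinders of the same index do not interleave: the first difference between
  \<open>f\<close> and \<open>g\<close> is before \<open>a\<close>, where every \<open>f'\<close> in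
  the cylinder agrees with \<open>f\<close>.\<close>

lemma cyl_separated:
  assumes "(f, g) \<in> lt lex_struct" "g \<notin> cyl f a" "f' \<in> cyl f a" "a \<in> Field k"
  shows "(f', g) \<in> lt lex_struct"
proof -
  obtain c where c: "lex_less f g c" and fg: "f \<in> fns" "g \<in> fns" using assms(1) by auto
  have cF: "c \<in> Field k" using c by (simp add: lex_less_def)
  have "c \<in> underS k a"
  proof (rule ccontr)
    assume n: "c \<notin> underS k a"
    then have "(a, c) \<in> k" using k_cases[OF cF assms(4)] k_refl[OF cF] by (auto simp: underS_def)
    then have "underS k a \<subseteq> underS k c" using underS_trans by blast
    then have "g \<in> cyl f a" using c fg(2) by (auto simp: lex_less_def cyl_def)
    then show False using assms(2) by blast
  qed
  moreover from this have "underS k c \<subseteq> underS k a"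
    using underS_trans unfolding underS_def by blast
  ultimately have "lex_less f' g c" using c assms(3) by (auto simp: lex_less_def cyl_def)
  then show ?thesis using assms(3) fg(2) by (auto simp: cyl_def)
qed

text \<open>Raise the value at \<open>a\<close>, which is possible as \<open>k\<close> has no last
  element.\<close>

lemma cyl_no_max:
  assumes "f \<in> fns" "a \<in> Field k" "g \<in> cyl f a"
  shows "\<exists>h\<in>cyl f a. (g, h) \<in> lt lex_struct"
proof -
  have g: "g \<in> fns" using assms(3) by (simp add: cyl_def)
  obtain m where m: "m \<in> Field k" "g a \<noteq> m" "(g a, m) \<in> k" using k_limit[OF fns_val[OF g assms(2)]] by blast
  have "g(a := m) \<in> cyl f a" using cyl_upd[OF g assms(2) m(1)] cyl_cong[OF assms(3)] by simp
  moreover have "g a \<in> underS k ((g(a := m)) a)" using m by (simp add: underS_def)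
  ultimately show ?thesis using cyl_less[OF assms(3) _ assms(2)] by blast
qed

text \<open>Contrapositive of regularity: a set that is too small is not cofinal, and in a linear
  order this means that it is bounded.\<close>

lemma bounded_if_small:
  assumes "A \<subseteq> Field k" "|A| <o k"
  shows "\<exists>j\<in>Field k. \<forall>x\<in>A. (x, j) \<in> k"
proof -
  have "\<not> cofinal A k"
    using reg assms not_ordLess_ordIso unfolding regularCard_def by blast
  then obtain j where j: "j \<in> Field k" "\<And>b. b \<in> A \<Longrightarrow> j = b \<or> (j, b) \<notin> k"
    unfolding cofinal_def by blast
  have "(x, j) \<in> k" if "x \<in> A" for x
    using j(2)[OF that] k_total[OF j(1), of x] k_refl[OF j(1)] assms(1) that by auto
  then show ?thesis using j(1) by blast
qed

lemma under_small: "i \<in> Field k \<Longrightarrow> |under k i| <o k"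
proof -
  assume i: "i \<in> Field k"
  obtain j where j: "j \<in> Field k" "i \<noteq> j" "(i, j) \<in> k" using k_limit[OF i] by blast
  have "under k i \<subseteq> underS k j" using j k_trans k_antisym unfolding under_def underS_def by blast
  then show ?thesis using card_of_mono1 card_of_underS[OF k(1) j(1)] ordLeq_ordLess_trans by blast
qed


section \<open>A copy of the superlimit model with the two contradictory properties\<close>

text \<open>Stage \<open>i\<close> treats the cylinders of index up to \<open>i\<close> and keeps
  the bounds they already have, so the bound obtained at stage \<open>a\<close> survives to the
  union. Treating fewer than \<open>k\<close> indices at a time is what lets regularity show that
  the sets \<open>T j\<close> exhaust \<open>Y\<close>.\<close>

lemma model_with_lubs:
  assumes card_fns: "|fns| \<le>o l"
  obtains Z :: "(('k \<Rightarrow> 'k) + 'k \<times> 'l) ostruct" where "lin Z" "isomorphic Z M"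
    "ord_emb Inl lex_struct Z"
    "\<And>f a. f \<in> fns \<Longrightarrow> a \<in> Field k \<Longrightarrow> \<exists>p. strict_lub Z (Inl ` cyl f a) p"
proof -
  define In :: "('k \<Rightarrow> 'k) \<Rightarrow> ('k \<Rightarrow> 'k) + 'k \<times> 'l" where "In = Inl"
  have In_inj: "inj_on In A" for A by (simp add: In_def inj_on_def)
  define B where "B = image_struct In lex_struct"
  have linB: "lin B" unfolding B_def by (rule lin_image_struct[OF lin_lex_struct In_inj])
  have uB: "universe B = In ` fns" by (simp add: B_def image_struct_def)
  have cardB: "|universe B| \<le>o l" unfolding uB by (rule image_le[OF card_fns])
  have embB: "ord_emb In lex_struct B"
    unfolding B_def using image_struct_less[OF lin_lex_struct In_inj]
    by (auto simp: ord_emb_def) (auto simp: image_struct_def)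
  have cyl_fns: "cyl f a \<subseteq> fns" for f a by (auto simp: cyl_def)
  define Q where "Q i W N \<longleftrightarrow> universe N \<subseteq> range In \<union> Inr ` (under k i \<times> UNIV) \<and>
    (\<forall>f\<in>fns. \<forall>a\<in>under k i. (\<exists>p. strict_lub N (In ` cyl f a) p) \<and>
      (\<forall>p. strict_lub W (In ` cyl f a) p \<longrightarrow> strict_lub N (In ` cyl f a) p))"
    for i and W N :: "(('k \<Rightarrow> 'k) + 'k \<times> 'l) ostruct"
  obtain N where N: "\<And>i. i \<in> Field k \<Longrightarrow> good_stage B Q N i (N i)"
    "\<And>i. i \<in> Field k \<Longrightarrow> lin (N i)"
    "\<And>i. i \<in> Field k \<Longrightarrow> substr B (N i)"
    "\<And>i j. (i, j) \<in> k \<Longrightarrow> substr (N i) (N j)"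
    "\<And>i. i \<in> Field k \<Longrightarrow> substr (N i) (union_struct (Field k) N)"
    "lin (union_struct (Field k) N)"
    "isomorphic (union_struct (Field k) N) M"
  proof (rule chain_exists[OF linB cardB, of Q])
    fix i and N :: "'k \<Rightarrow> (('k \<Rightarrow> 'k) + 'k \<times> 'l) ostruct"
    assume i: "i \<in> Field k" and linW: "lin (stage B N i)"
      and card: "|universe (stage B N i)| \<le>o l"
      and g: "\<And>j. j \<in> underS k i \<Longrightarrow> good_stage B Q N j (N j)"
      and subB: "substr B (stage B N i)"
    define W where "W = stage B N i"
    note linW = linW[folded W_def] and card = card[folded W_def] and subB = subB[folded W_def]
    have embW: "ord_emb In lex_struct W" by (rule ord_emb_comp[OF embB subB])
    have Wsub: "universe W \<subseteq> range In \<union> Inr ` (underS k i \<times> UNIV)"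
    proof
      fix x assume "x \<in> universe W"
      then consider "x \<in> universe B" | j where "j \<in> underS k i" "x \<in> universe (N j)"
        by (auto simp: W_def universe_stage)
      then show "x \<in> range In \<union> Inr ` (underS k i \<times> UNIV)"
      proof cases
        case 1 then show ?thesis unfolding uB by blast
      next
        case (2 j)
        then have "x \<in> range In \<union> Inr ` (under k j \<times> UNIV)"
          using g[OF 2(1)] unfolding good_stage_def Q_def by blast
        moreover have "under k j \<subseteq> underS k i"
          using 2(1) k_trans k_antisym by (auto simp: under_def underS_def)
        ultimately show ?thesis by blast
      qed
    qed
    have aF: "a \<in> Field k" if "a \<in> under k i" for a using that by (auto simp: under_def Field_def)
    define F where "F = (\<lambda>(f, a). In ` cyl f a) ` (fns \<times> under k i)"
    have FI: "In ` cyl f a \<in> F" if "f \<in> fns" "a \<in> under k i" for f a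
      using that unfolding F_def by force
    have Fsub: "A \<subseteq> universe W" if "A \<in> F" for A
      using that cyl_fns ord_emb_mem[OF embW] by (fastforce simp: F_def)
    have Fmax: "\<exists>b\<in>A. (x, b) \<in> lt W" if A: "A \<in> F" and x: "x \<in> A" for A x
    proof -
      obtain f a where fa: "f \<in> fns" "a \<in> under k i" "A = In ` cyl f a" using A by (auto simp: F_def)
      then obtain g' where g': "x = In g'" "g' \<in> cyl f a" using x by blast
      obtain h where "h \<in> cyl f a" "(g', h) \<in> lt lex_struct"
        using cyl_no_max[OF fa(1) aF[OF fa(2)] g'(2)] by blast
      then show ?thesis using ord_emb_lessD[OF embW lin_lex_struct] fa(3) g'(1) by blast
    qed
    have cardF: "|F| \<le>o l"
      unfolding F_def
      by (intro image_le Times_le card_fns subset_le[OF _ card_k_le]) (use aF in blast)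
    obtain Y :: "(('k \<Rightarrow> 'k) + 'k \<times> 'l) set ostruct" and e h where Y: "lin Y" "ord_emb e W Y"
      "universe Y \<subseteq> e ` universe W \<union> h ` F"
      and lubF: "\<And>A. A \<in> F \<Longrightarrow> \<exists>p. strict_lub Y (e ` A) p"
        "\<And>A p. A \<in> F \<Longrightarrow> strict_lub W A p \<Longrightarrow> strict_lub Y (e ` A) (e p)"
      by (rule add_lubs[OF linW Fsub Fmax]) (assumption | rule that)+
    have cardY: "|universe Y| \<le>o l" by (rule subset_le[OF Y(3)]) (intro Un_le image_le card cardF)
    define dd where "dd f = e (In f)" for f
    have embdd: "ord_emb dd lex_struct Y" unfolding dd_def by (rule ord_emb_comp[OF embW Y(2)])
    have ddless: "(dd g, dd h) \<in> lt Y" if "(g, h) \<in> lt lex_struct" for g h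
      by (rule ord_emb_lessD[OF embdd lin_lex_struct that])
    have dd_img: "e ` In ` A = dd ` A" for A by (auto simp: dd_def)
    \<comment> \<open>\<open>T j\<close> omits what lies above some \<open>g \<in> [f|a]\<close> with \<open>g(a) > j\<close> but below the least upper bound
      of \<open>[f|a]\<close>; so it does not approach that bound.\<close>
    define bad where "bad y f a j \<longleftrightarrow> (j, f a) \<in> k \<and> j \<noteq> f a \<and>
      (\<exists>p. strict_lub Y (dd ` cyl f a) p \<and> y \<in> seg Y (dd f) p)" for y f a j
    define T where "T j = {y \<in> universe Y. \<forall>f\<in>fns. \<forall>a\<in>under k i. \<not> bad y f a j}" for j
    have bad_mono: "bad y f a j" if "bad y f a j'" "(j, j') \<in> k" for y f a j j'
      using that k_trans[of j j' "f a"] k_antisym[of j j'] unfolding bad_def by metis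
    have Tmono: "T j \<subseteq> T j'" if "(j, j') \<in> k" for j j'
      using bad_mono[OF _ that] unfolding T_def by blast
    have TY: "universe Y = (\<Union>j\<in>Field k. T j)"
    proof
      show "(\<Union>j\<in>Field k. T j) \<subseteq> universe Y" by (auto simp: T_def)
      show "universe Y \<subseteq> (\<Union>j\<in>Field k. T j)"
      proof
        fix y assume y: "y \<in> universe Y"
        \<comment> \<open>For fixed \<open>a\<close> only one cylinder can have \<open>y\<close>
          between an element and its bound. An element \<open>g\<close> of it above \<open>y\<close>
          yields the threshold \<open>m = g a\<close>.\<close>
        have "\<exists>m\<in>Field k. \<forall>f\<in>fns. \<not> bad y f a m" if a: "a \<in> under k i" for a
        proof (cases "\<exists>f\<in>fns. \<exists>p. strict_lub Y (dd ` cyl f a) p \<and> y \<in> seg Y (dd f) p")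
          case False
          then show ?thesis using aF[OF a] unfolding bad_def by blast
        next
          case True
          then obtain f p where f: "f \<in> fns" "strict_lub Y (dd ` cyl f a) p" "y \<in> seg Y (dd f) p"
            by blast
          then obtain g where g: "g \<in> cyl f a" "(y, dd g) \<in> lt Y"
            unfolding strict_lub_def seg_def by blast
          have gF: "g a \<in> Field k" using g(1) fns_val aF[OF a] by (auto simp: cyl_def)
          have "\<not> bad y f' a (g a)" if f': "f' \<in> fns" for f'
          proof
            assume "bad y f' a (g a)"
            then obtain p' where p': "(g a, f' a) \<in> k" "g a \<noteq> f' a"
              "strict_lub Y (dd ` cyl f' a) p'" "y \<in> seg Y (dd f') p'"
              unfolding bad_def by blast
            obtain g' where g': "g' \<in> cyl f' a" "(y, dd g') \<in> lt Y"
              using p'(3,4) unfolding strict_lub_def seg_def by blast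
            have no: "\<not> ((y, dd h) \<in> lt Y \<and> y \<in> seg Y (dd h') q)"
              if "(h, h') \<in> lt lex_struct" for h h' q
              using ddless[OF that] lin_trans[OF Y(1)] lin_irrefl[OF Y(1)] unfolding seg_def by blast
            show False
            \<comment> \<open>In the same cylinder, the larger value at \<open>a\<close> puts
              \<open>f'\<close> above \<open>g\<close> and hence above \<open>y\<close>. Otherwise
              one cylinder lies wholly below the other, so \<open>y\<close> cannot be caught in
              both.\<close>
            proof (cases "f' \<in> cyl f a")
              case True
              have "(g, f') \<in> lt lex_struct"
                by (rule cyl_less[OF g(1) True aF[OF a]]) (use p' in \<open>simp add: underS_def\<close>)
              then show False using no g(2) p'(4) by blast
            next
              case False
              then have nf: "f \<notin> cyl f' a" using f(1) f' unfolding cyl_def by force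
              have "f \<noteq> f'" using False f(1) cyl_self by blast
              then consider "(f, f') \<in> lt lex_struct" | "(f', f) \<in> lt lex_struct"
                using lin_total[OF lin_lex_struct, of f f'] f(1) f' by auto
              then show False
              proof cases
                case 1
                have "(g, f') \<in> lt lex_struct"
                  by (rule cyl_separated[OF 1 False g(1) aF[OF a]])
                then show False using no g(2) p'(4) by blast
              next
                case 2
                have "(g', f) \<in> lt lex_struct"
                  by (rule cyl_separated[OF 2 nf g'(1) aF[OF a]])
                then show False using no g'(2) f(3) by blast
              qed
            qed
          qed
          then show ?thesis using gF by blast
        qed
        then obtain m where m: "\<And>a. a \<in> under k i \<Longrightarrow> m a \<in> Field k"
          "\<And>a f. a \<in> under k i \<Longrightarrow> f \<in> fns \<Longrightarrow> \<not> bad y f a (m a)"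
          by metis
        have "|m ` under k i| <o k"
          using card_of_image under_small[OF i] ordLeq_ordLess_trans by blast
        \<comment> \<open>Regularity: the thresholds of fewer than \<open>k\<close> indices have a
          common bound \<open>j\<close>.\<close>
        then obtain j where j: "j \<in> Field k" "\<And>a. a \<in> under k i \<Longrightarrow> (m a, j) \<in> k"
          using bounded_if_small[of "m ` under k i"] m(1) by blast
        have "\<not> bad y f a j" if "a \<in> under k i" "f \<in> fns" for a f
          using m(2)[OF that] bad_mono[OF _ j(2)[OF that(1)]] by blast
        then have "y \<in> T j" using y unfolding T_def by blast
        then show "y \<in> (\<Union>j\<in>Field k. T j)" using j(1) by blast
      qed
    qed
    have escape: "left_isolated Y (T j) p"
      if fa: "f \<in> fns" "a \<in> under k i" and p: "strict_lub Y (dd ` cyl f a) p" and j: "j \<in> Field k"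
      for f a p j
    proof -
      obtain m where m: "m \<in> Field k" "j \<noteq> m" "(j, m) \<in> k" using k_limit[OF j] by blast
      \<comment> \<open>As \<open>m\<close> is above \<open>j\<close>, the image of this function
        starts an interval below \<open>p\<close> that \<open>T j\<close> omits.\<close>
      let ?f = "f(a := m)"
      have f': "?f \<in> cyl f a" by (rule cyl_upd[OF fa(1) aF[OF fa(2)] m(1)])
      have "\<not> y \<in> T j" if y: "y \<in> seg Y (dd ?f) p" for y
      proof -
        have "bad y ?f a j" unfolding bad_def cyl_cong[OF f'] using m p y by auto
        then show ?thesis using f' fa(2) cyl_fns unfolding T_def by blast
      qed
      moreover have "(dd ?f, p) \<in> lt Y" using f' p unfolding strict_lub_def by blast
      ultimately show ?thesis unfolding left_isolated_def by blast
    qed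
    obtain g where g': "ord_emb g Y M"
      and cof: "\<And>p x. p \<in> universe Y \<Longrightarrow> \<forall>i\<in>Field k. left_isolated Y (T i) p \<Longrightarrow>
        (x, g p) \<in> lt M \<Longrightarrow> \<exists>y. (y, p) \<in> lt Y \<and> (x, g y) \<in> lt M"
      by (rule embed_cofinal[OF Y(1) cardY TY Tmono], assumption) (rule that; assumption)
    have V: "(Inr ` ({i} \<times> Field l)) \<inter> universe W = {}"
      using Wsub unfolding In_def by (auto simp: underS_def)
    have V2: "|universe M| \<le>o |Inr ` ({i} \<times> Field l) :: (('k \<Rightarrow> 'k) + 'k \<times> 'l) set|"
      by (rule fresh_card) simp
    obtain X \<phi> where X: "bij_betw \<phi> (universe M) (universe X)" "ord_emb \<phi> M X" "lin X"
      "\<And>w. w \<in> universe W \<Longrightarrow> \<phi> (g (e w)) = w"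
      "universe X \<subseteq> universe W \<union> Inr ` ({i} \<times> Field l)" "substr W X"
      by (rule transport[OF M_lin Y(1) linW g' Y(2) V V2]) (rule that; assumption)
    \<comment> \<open>\<open>embed_cofinal\<close> carries the bound from \<open>Y\<close> to
      \<open>M\<close> and the isomorphism \<open>\<phi>\<close> carries it to \<open>X\<close>,
      where the elements of the cylinder have their original names again.\<close>
    have lubX: "strict_lub X (In ` cyl f a) (\<phi> (g p))"
      if fa: "f \<in> fns" "a \<in> under k i" and p: "strict_lub Y (dd ` cyl f a) p" for f a p
    proof -
      have "strict_lub M (g ` dd ` cyl f a) (g p)"
      proof (rule strict_lub_emb[OF g' Y(1) M_lin p])
        have "p \<in> universe Y" "\<forall>i\<in>Field k. left_isolated Y (T i) p"
          using p escape[OF fa p] by (auto simp: strict_lub_def)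
        then show "\<exists>y. (y, p) \<in> lt Y \<and> (x, g y) \<in> lt M" if "(x, g p) \<in> lt M" for x
          using that by (rule cof)
      qed
      then have "strict_lub X (\<phi> ` g ` dd ` cyl f a) (\<phi> (g p))"
        by (rule strict_lub_iso[OF X(1,2) M_lin X(3)])
      moreover have "\<phi> (g (dd h)) = In h" if "h \<in> cyl f a" for h
        using X(4) ord_emb_mem[OF embW] cyl_fns that unfolding dd_def by fastforce
      ultimately show ?thesis by (simp add: image_image cong: image_cong)
    qed
    have "Q i W X"
      unfolding Q_def
    proof (intro conjI ballI allI impI)
      have "underS k i \<subseteq> under k i" "i \<in> under k i" by (simp_all add: under_eq[OF i]) blast
      then show "universe X \<subseteq> range In \<union> Inr ` (under k i \<times> UNIV)"
        using X(5) Wsub by blast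
      fix f a assume fa: "f \<in> fns" "a \<in> under k i"
      show "\<exists>p. strict_lub X (In ` cyl f a) p"
        using lubF(1)[OF FI[OF fa]] lubX[OF fa] unfolding dd_img by blast
      \<comment> \<open>An old bound \<open>p\<close> becomes \<open>e p\<close> in
        \<open>Y\<close>, and \<open>transport\<close> has renamed its image back to
        \<open>p\<close>.\<close>
      fix p assume p: "strict_lub W (In ` cyl f a) p"
      then have "strict_lub X (In ` cyl f a) (\<phi> (g (e p)))"
        using lubF(2)[OF FI[OF fa] p] lubX[OF fa] unfolding dd_img by blast
      moreover have "\<phi> (g (e p)) = p" using X(4) p by (simp add: strict_lub_def)
      ultimately show "strict_lub X (In ` cyl f a) p" by simp
    qed
    then have "good_stage B Q N i X"
      using X(3,6) isomorphic_sym[OF isomorphicI[OF X(1,2)]]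
      by (auto simp: good_stage_def W_def)
    then show "\<exists>X. good_stage B Q N i X" by blast
  qed blast
  let ?U = "union_struct (Field k) N"
  show thesis
  proof (rule that[OF N(6,7)])
    obtain i where i: "i \<in> Field k" using k_nonempty by blast
    have "ord_emb In lex_struct ?U"
      by (rule ord_emb_comp[OF ord_emb_comp[OF embB N(3)[OF i]] N(5)[OF i]])
    then show "ord_emb Inl lex_struct ?U" by (simp add: In_def)
    fix f a assume fa: "f \<in> fns" "a \<in> Field k"
    let ?A = "In ` cyl f a"
    have aa: "a \<in> under k a" using k_refl[OF fa(2)] by (simp add: under_def)
    obtain p where p: "strict_lub (N a) ?A p"
      using N(1)[OF fa(2)] fa(1) aa unfolding good_stage_def Q_def by blast
    have ltN: "lt (N m) \<subseteq> lt (N n)" if "(m, n) \<in> k" for m n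
      using ord_emb_lessD[OF N(4)[OF that] N(2)] k_dom[OF that] by auto
    have ltB: "lt B \<subseteq> lt (N a)" using ord_emb_lessD[OF N(3)[OF fa(2)] linB] by auto
    \<comment> \<open>A point below \<open>p\<close> may come from a member before
      \<open>N a\<close>, where \<open>p\<close> need not be a least upper bound; it is then below
      \<open>p\<close> in \<open>N a\<close> as well.\<close>
    have step: "\<exists>m\<in>I. (x, p) \<in> lt (N m) \<and> strict_lub (N m) ?A p"
      if "\<And>m. (a, m) \<in> k \<Longrightarrow> m \<in> I \<Longrightarrow> strict_lub (N m) ?A p" "n \<in> I" "a \<in> I" "I \<subseteq> Field k"
        "(x, p) \<in> lt (N n)" for I n x
    proof (cases "(a, n) \<in> k")
      case True
      then show ?thesis using that by blast
    next
      case False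
      then have "(n, a) \<in> k" using k_total[OF fa(2)] that(2,4) by blast
      then show ?thesis using ltN that(3,5) p by blast
    qed
    have lubN: "strict_lub (N j) ?A p" if "(a, j) \<in> k" for j
      using k_wf that
    proof (induction j rule: wf_induct_rule)
      case (less j)
      show ?case
      proof (cases "a = j")
        case True then show ?thesis using p by simp
      next
        case False
        then have aj: "a \<in> underS k j" using less.prems by (simp add: underS_def)
        have j: "j \<in> Field k" using less.prems k_dom by blast
        \<comment> \<open>The bound passes from earlier members to the stage as a union, and from
          the stage to \<open>N j\<close> by the preservation clause of \<open>Q\<close>.\<close>
        have "strict_lub (stage B N j) ?A p"
        proof (rule strict_lub_union[of "underS k j" N, OF _ _ aj p])
          show "lt (N m) \<subseteq> lt (stage B N j)" "universe (N m) \<subseteq> universe (stage B N j)"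
            if "m \<in> underS k j" for m using that by (auto simp: universe_stage lt_stage)
          fix x assume "(x, p) \<in> lt (stage B N j)"
          then obtain n where n: "n \<in> underS k j" "(x, p) \<in> lt (N n)"
            using ltB aj by (auto simp: lt_stage)
          show "\<exists>m\<in>underS k j. (x, p) \<in> lt (N m) \<and> strict_lub (N m) ?A p"
          proof (rule step[OF _ n(1) aj _ n(2)])
            show "strict_lub (N m) ?A p" if "(a, m) \<in> k" "m \<in> underS k j" for m
              using less.IH[of m] that by (simp add: underS_def)
          qed (use underS_Field' in blast)
        qed
        moreover have "a \<in> under k j" using less.prems by (simp add: under_def)
        ultimately show ?thesis using N(1)[OF j] fa(1) unfolding good_stage_def Q_def by blast
      qed
    qed
    have "strict_lub ?U ?A p"
    proof (rule strict_lub_union[of "Field k" N, OF _ _ fa(2) p])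
      fix x assume "(x, p) \<in> lt ?U"
      then obtain n where n: "n \<in> Field k" "(x, p) \<in> lt (N n)" by auto
      show "\<exists>m\<in>Field k. (x, p) \<in> lt (N m) \<and> strict_lub (N m) ?A p"
        by (rule step[OF lubN n(1) fa(2) _ n(2)]) auto
    qed auto
    then show "\<exists>p. strict_lub ?U (Inl ` cyl f a) p" unfolding In_def by blast
  qed
qed

section \<open>The diagonal argument\<close>

lemma no_superlimit:
  assumes card_fns: "|fns| \<le>o l"
  shows False
proof -
  obtain Z :: "(('k \<Rightarrow> 'k) + 'k \<times> 'l) ostruct" where Z: "lin Z" "isomorphic Z M"
    "ord_emb Inl lex_struct Z"
    "\<And>f a. f \<in> fns \<Longrightarrow> a \<in> Field k \<Longrightarrow> \<exists>p. strict_lub Z (Inl ` cyl f a) p"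
    by (rule model_with_lubs[OF card_fns]) (rule that; assumption)
  obtain h where h: "bij_betw h (universe Z) (universe M)" "ord_emb h Z M"
    using Z(2) by (rule isomorphicE)
  obtain S where S: "universe M = (\<Union>i\<in>Field k. S i)"
    "\<And>i p. i \<in> Field k \<Longrightarrow> p \<in> universe M \<Longrightarrow> left_isolated M (S i) p"
    by (rule sparse_decomposition) (rule that; assumption)
  define dd where "dd f = h (Inl f)" for f
  have dd: "ord_emb dd lex_struct M" unfolding dd_def by (rule ord_emb_comp[OF Z(3) h(2)])
  \<comment> \<open>The value at \<open>a\<close> must keep every function that agrees with
    \<open>f\<close> up to and including \<open>a\<close> out of \<open>S a\<close>. Outside
    \<open>Field k\<close> nothing is required.\<close>
  define P where "P f a m \<longleftrightarrow> (a \<in> Field k \<longrightarrow> m \<in> Field k \<and>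
    (\<forall>g\<in>fns. (\<forall>b\<in>underS k a. g b = f b) \<longrightarrow> g a = m \<longrightarrow> dd g \<notin> S a))" for f a m
  have "\<exists>f. \<forall>a. P f a (f a)"
  proof (rule dependent_wf_choice[OF k_wf])
    fix f f' :: "'k \<Rightarrow> 'k" and a m
    assume "\<And>z. (z, a) \<in> k - Id \<Longrightarrow> f z = f' z"
    then have "\<forall>b\<in>underS k a. f b = f' b" by (auto simp: underS_def)
    then show "P f a m = P f' a m" unfolding P_def by auto
  next
    fix a and f :: "'k \<Rightarrow> 'k"
    assume IH: "\<And>b. (b, a) \<in> k - Id \<Longrightarrow> P f b (f b)"
    show "\<exists>m. P f a m"
    proof (cases "a \<in> Field k")
      case a: True
      \<comment> \<open>An element of \<open>fns\<close> that continues the values before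
        \<open>a\<close>. Its later values are an arbitrary choice from \<open>Field k\<close>; the
        cylinder does not depend on them.\<close>
      define f0 where "f0 b = (if b \<in> underS k a then f b else if b \<in> Field k then a else undefined)" for b
      have "f b \<in> Field k" if "b \<in> underS k a" for b
        using IH[of b] that underS_Field'[OF that] by (auto simp: P_def underS_def)
      then have f0: "f0 \<in> fns"
        using a underS_Field' by (auto simp: fns_def Func_def f0_def)
      obtain p0 where "strict_lub Z (Inl ` cyl f0 a) p0" using Z(4)[OF f0 a] by blast
      then have "strict_lub M (h ` Inl ` cyl f0 a) (h p0)" by (rule strict_lub_iso[OF h Z(1) M_lin])
      then obtain p where p: "strict_lub M (dd ` cyl f0 a) p" by (auto simp: dd_def image_image)
      \<comment> \<open>\<open>S a\<close> avoids an interval from \<open>q\<close> up to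
        \<open>p\<close>. The cylinder is cofinal below \<open>p\<close>, so some \<open>g\<close>
        in it is above \<open>q\<close>; any function of the cylinder whose value at
        \<open>a\<close> exceeds \<open>g a\<close> then falls into the interval.\<close>
      then obtain q where q: "(q, p) \<in> lt M" "seg M q p \<inter> S a = {}"
        using S(2)[OF a, of p] unfolding left_isolated_def strict_lub_def by blast
      then obtain g where g: "g \<in> cyl f0 a" "(q, dd g) \<in> lt M"
        using p unfolding strict_lub_def by blast
      have "g a \<in> Field k" using g(1) fns_val a by (auto simp: cyl_def)
      then obtain m where m: "m \<in> Field k" "g a \<noteq> m" "(g a, m) \<in> k" using k_limit by blast
      have "dd g' \<notin> S a" if g': "g' \<in> fns" "\<forall>b\<in>underS k a. g' b = f b" "g' a = m" for g'
      proof -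
        have c: "g' \<in> cyl f0 a" using g' by (auto simp: cyl_def f0_def)
        have "(g, g') \<in> lt lex_struct"
          by (rule cyl_less[OF g(1) c a]) (use m g'(3) in \<open>simp add: underS_def\<close>)
        then have "(q, dd g') \<in> lt M"
          using g(2) lin_trans[OF M_lin] ord_emb_lessD[OF dd lin_lex_struct] by blast
        moreover have "(dd g', p) \<in> lt M" using p c unfolding strict_lub_def by blast
        ultimately show ?thesis using q(2) unfolding seg_def by blast
      qed
      then show ?thesis using m(1) unfolding P_def by blast
    qed (simp add: P_def)
  qed
  then obtain f where f: "\<And>a. P f a (f a)" by blast
  \<comment> \<open>The recursion leaves \<open>f\<close> arbitrary outside \<open>Field k\<close>,
    where \<open>fns\<close> demands \<open>undefined\<close>.\<close>
  define f' where "f' a = (if a \<in> Field k then f a else undefined)" for a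
  have f': "f' \<in> fns" using f by (auto simp: f'_def fns_def Func_def P_def)
  then have "dd f' \<in> universe M" using ord_emb_mem[OF dd] by simp
  then obtain a where a: "a \<in> Field k" "dd f' \<in> S a" using S(1) by blast
  moreover have "\<forall>b\<in>underS k a. f' b = f b" using underS_Field' by (auto simp: f'_def)
  ultimately show False using f[of a] f' by (auto simp: P_def f'_def)
qed

end

text \<open>Here \<open>l = l^{<l}\<close> enters: \<open>k\<close> has the size of a proper initial
  segment of \<open>l\<close>, so there are at most as many functions as from that segment to
  \<open>l\<close>, and these form one summand of \<open>cexp_less l l\<close>.\<close>

lemma card_Func_le_cexp_less:
  assumes l: "Card_order l" "l =o cexp_less l l" and k: "Card_order k" and kl: "k <o l"
    and ne: "Field k \<noteq> {}"
  shows "|Func (Field k) (Field k)| \<le>o l"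
proof -
  have wo: "Well_order l" "Well_order k" using l(1) k by (simp_all add: card_order_on_def)
  obtain a where a: "a \<in> Field l" "k =o Restr l (underS l a)"
    using kl ordLess_iff_ordIso_Restr[OF wo] by blast
  let ?A = "underS l a"
  have "Field (Restr l ?A) = ?A"
    using wo_rel.underS_ofilter[of l a] wo(1) by (simp add: wo_rel_def Field_Restr_ofilter)
  then have "|Field k| =o | ?A|"
    using a(2) by (metis card_of_cong)
  then have kA: "k =o | ?A|" using card_of_Field_ordIso[OF k] ordIso_symmetric ordIso_transitive by blast
  have "k ^c k \<le>o l ^c | ?A|"
    by (rule cexp_mono'[OF ordLess_imp_ordLeq[OF kl] ordIso_imp_ordLeq[OF kA]]) (use ne in simp)
  then have "|Func (Field k) (Field k)| \<le>o |Func ?A (Field l)|"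
    by (simp add: cexp_def Field_card_of)
  also have "|Func ?A (Field l)| \<le>o cexp_less l l"
    unfolding cexp_less_def
    using a(1) by (intro card_of_ordLeqI[of "Pair a"]) (auto simp: inj_on_def)
  also have "cexp_less l l =o l" using l(2) by (rule ordIso_symmetric)
  finally show ?thesis .
qed

theorem claim3p10:
  fixes l :: "'l rel" and k :: "'k rel"
  assumes "Card_order l" and "cinfinite l"
    and "Card_order k" and "cinfinite k"
    and "l =o cexp_less l l"
    and "k <o l"
    and "regularCard k"
  shows "\<not> (\<exists>M :: 'a ostruct. superlimit l k T_ord M)"
proof
  assume "\<exists>M :: 'a ostruct. superlimit l k T_ord M"
  then obtain M :: "'a ostruct" where "superlimit l k T_ord M" by blast
  then interpret superlimit_order l k M
    using assms by unfold_locales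
  have "|fns| \<le>o l"
    unfolding fns_def
    by (rule card_Func_le_cexp_less[OF assms(1,5,3,6)]) (rule k_nonempty)
  then show False by (rule no_superlimit)
qed

end
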